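(* The degrees of the elements of the Graver basis of a toric ideal cannot be bounded polynomially in the maximal true degree of a circuit: for every polynomial $p$ with real coefficients there exist a finite vector configuration $A\subseteq\mathbb{N}^n$ (indeed one can take $A=A_{G_r^n}$ for suitable odd $n\ge3$ and $r$) and an element $B$ of the Graver basis $Gr_A$ of $I_A$ with $\deg(B)>p(t_A)$. More specifically, for fixed odd $n\ge3$, $t_{A_{G_r^n}}\le n+(2r-1)(n-1)$ grows at most linearly in $r$, while $Gr_{A_{G_r^n}}$ contains an element of degree $\frac12\left(n+n^2\frac{(n-1)^r-1}{n-2}\right)$, which grows exponentially in $r$.
   Context: For a finite set $A=\{\mathbf a_1,\dots,\mathbf a_m\}\subseteq\mathbb{N}^n$, the toric ideal $I_A\subseteq\mathbb{K}[x_1,\dots,x_m]$ ($\mathbb{K}$ a field) is generated by all binomials $\mathbf{x}^{\mathbf u}-\mathbf{x}^{\mathbf v}$ with $\mathbf u,\mathbf v\in\mathbb{N}^m$ and $\sum u_i\mathbf a_i=\sum v_i\mathbf a_i$. The degree of a binomial $\mathbf{x}^{\mathbf u}-\mathbf{x}^{\mathbf v}$ is $\max(\deg\mathbf{x}^{\mathbf u},\deg\mathbf{x}^{\mathbf v})$ (total degrees). A nonzero binomial $\mathbf{x}^{\mathbf u}-\mathbf{x}^{\mathbf v}\in I_A$ is primitive if there is no other binomial $\mathbf{x}^{\mathbf w}-\mathbf{x}^{\mathbf z}\in I_A$ with $\mathbf{x}^{\mathbf w}\mid\mathbf{x}^{\mathbf u}$ and $\mathbf{x}^{\mathbf z}\mid\mathbf{x}^{\mathbf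 v}$; the Graver basis $Gr_A$ is the set of primitive binomials. A circuit is an irreducible binomial of $I_A$ with minimal support (set of variables occurring); $\operatorname{supp}(C)$ is regarded as the subset of $A$ of vectors $\mathbf a_i$ with $x_i$ occurring in $C$. The index of a circuit $C$ is $[\mathbb{R}\operatorname{supp}(C)\cap\mathbb{Z}A:\mathbb{Z}\operatorname{supp}(C)]$, its true degree is $\deg(C)\cdot\operatorname{index}(C)$, and $t_A$ is the maximum true degree of a circuit of $I_A$. For a graph $G$, $A_G=\{\mathbf v_i+\mathbf v_j:\{v_i,v_j\}\in E(G)\}\subseteq\mathbb{Z}^{|V(G)|}$ ($\mathbf v_k$ standard basis vectors). Graphs $G_r^n$: for odd $n\ge3$, $G_0^n$ is a cycle of length $n$; for $r\ge1$, $G_r^n$ is obtained from $G_{r-1}^n$ by attaching, at each vertex $v$ of degree two in $G_{r-1}^n$, a new cycle of length $n$ sharing exactly the vertex $v$ with $G_{r-1}^n$ (the new cycles otherwise pairwise vertex-disjoint and disjoint from $G_{r-1}^n$). *)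

theory Defs
  imports Main "HOL-Computational_Algebra.Polynomial"
begin

text \<open>A vector configuration is a finite set A of vectors of type 'v => nat
  (coordinates indexed by 'v).  Variables x_a of the polynomial ring are indexed by
  the elements a of A; a monomial x^u is given by its exponent vector
  u :: ('v => nat) => nat, which must vanish outside A.  A binomial x^u - x^v is
  represented by the pair (u, v).\<close>

definition expvec :: "('v \<Rightarrow> nat) set \<Rightarrow> (('v \<Rightarrow> nat) \<Rightarrow> nat) \<Rightarrow> bool" where
  "expvec A u \<longleftrightarrow> (\<forall>x. x \<notin> A \<longrightarrow> u x = 0)"

definition in_toric :: "('v \<Rightarrow> nat) set \<Rightarrow> (('v \<Rightarrow> nat) \<Rightarrow> nat) \<Rightarrow> (('v \<Rightarrow> nat) \<Rightarrow> nat) \<Rightarrow> bool" where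
  "in_toric A u v \<longleftrightarrow> expvec A u \<and> expvec A v \<and>
     (\<forall>j. (\<Sum>x\<in>A. u x * x j) = (\<Sum>x\<in>A. v x * x j))"

definition bdeg :: "('v \<Rightarrow> nat) set \<Rightarrow> (('v \<Rightarrow> nat) \<Rightarrow> nat) \<Rightarrow> (('v \<Rightarrow> nat) \<Rightarrow> nat) \<Rightarrow> nat" where
  "bdeg A u v = max (\<Sum>x\<in>A. u x) (\<Sum>x\<in>A. v x)"

definition primitive :: "('v \<Rightarrow> nat) set \<Rightarrow> (('v \<Rightarrow> nat) \<Rightarrow> nat) \<Rightarrow> (('v \<Rightarrow> nat) \<Rightarrow> nat) \<Rightarrow> bool" where
  "primitive A u v \<longleftrightarrow> in_toric A u v \<and> u \<noteq> v \<and>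
     (\<forall>w z. in_toric A w z \<and> w \<noteq> z \<and> (\<forall>x. w x \<le> u x) \<and> (\<forall>x. z x \<le> v x)
        \<longrightarrow> w = u \<and> z = v)"

definition graver_basis :: "('v \<Rightarrow> nat) set \<Rightarrow> ((('v \<Rightarrow> nat) \<Rightarrow> nat) \<times> (('v \<Rightarrow> nat) \<Rightarrow> nat)) set" where
  "graver_basis A = {(u, v). primitive A u v}"

definition bsupp :: "('v \<Rightarrow> nat) set \<Rightarrow> (('v \<Rightarrow> nat) \<Rightarrow> nat) \<Rightarrow> (('v \<Rightarrow> nat) \<Rightarrow> nat) \<Rightarrow> ('v \<Rightarrow> nat) set" where
  "bsupp A u v = {x \<in> A. u x \<noteq> 0 \<or> v x \<noteq> 0}"

text \<open>Irreducibility of a binomial x^u - x^v (u ~= v) as a polynomial: the two monomials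
  have no common variable and the gcd of all exponents is 1.\<close>
definition irred_binomial :: "(('v \<Rightarrow> nat) \<Rightarrow> nat) \<Rightarrow> (('v \<Rightarrow> nat) \<Rightarrow> nat) \<Rightarrow> bool" where
  "irred_binomial u v \<longleftrightarrow> (\<forall>x. u x = 0 \<or> v x = 0) \<and>
     (\<forall>d::nat. (\<forall>x. d dvd u x \<and> d dvd v x) \<longrightarrow> d = 1)"

definition circuit :: "('v \<Rightarrow> nat) set \<Rightarrow> (('v \<Rightarrow> nat) \<Rightarrow> nat) \<Rightarrow> (('v \<Rightarrow> nat) \<Rightarrow> nat) \<Rightarrow> bool" where
  "circuit A u v \<longleftrightarrow> in_toric A u v \<and> u \<noteq> v \<and> irred_binomial u v \<and>
     \<not> (\<exists>w z. in_toric A w z \<and> w \<noteq> z \<and> bsupp A w z \<subset> bsupp A u v)"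

definition int_span :: "('v \<Rightarrow> nat) set \<Rightarrow> ('v \<Rightarrow> int) set" where
  "int_span S = {y. \<exists>c::('v \<Rightarrow> nat) \<Rightarrow> int. y = (\<lambda>j. \<Sum>x\<in>S. c x * int (x j))}"

definition real_span_int :: "('v \<Rightarrow> nat) set \<Rightarrow> ('v \<Rightarrow> int) set" where
  "real_span_int S = {y. \<exists>r::('v \<Rightarrow> nat) \<Rightarrow> real. \<forall>j. real_of_int (y j) = (\<Sum>x\<in>S. r x * real (x j))}"

definition lattice_index :: "('v \<Rightarrow> nat) set \<Rightarrow> ('v \<Rightarrow> nat) set \<Rightarrow> nat" where
  "lattice_index A S =
     card ((real_span_int S \<inter> int_span A) //
       {(y, z). y \<in> real_span_int S \<inter> int_span A \<and> z \<in> real_span_int S \<inter> int_span A \<and>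
                y - z \<in> int_span S})"

definition true_degree :: "('v \<Rightarrow> nat) set \<Rightarrow> (('v \<Rightarrow> nat) \<Rightarrow> nat) \<Rightarrow> (('v \<Rightarrow> nat) \<Rightarrow> nat) \<Rightarrow> nat" where
  "true_degree A u v = bdeg A u v * lattice_index A (bsupp A u v)"

definition tA :: "('v \<Rightarrow> nat) set \<Rightarrow> nat" where
  "tA A = Max {true_degree A u v | u v. circuit A u v}"

text \<open>A_G for a graph given by its edge set E (edges are 2-element vertex sets):
  the vectors v_i + v_j, i.e. indicator vectors of the edges.\<close>
definition AG :: "'v set set \<Rightarrow> ('v \<Rightarrow> nat) set" where
  "AG E = (\<lambda>e. (\<lambda>w. if w \<in> e then 1 else 0)) ` E"

text \<open>Concrete model of G_r^n.  Vertices are lists: level-0 vertices [k] (k < n) form the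
  cycle G_0^n; a vertex v of level l (length l+1) that has degree two in G_l^n gets a new
  cycle v, v@[1], ..., v@[n-1] attached at level l+1.\<close>
definition gverts :: "nat \<Rightarrow> nat \<Rightarrow> nat list set" where
  "gverts n r = {xs. 1 \<le> length xs \<and> length xs \<le> r + 1 \<and> hd xs < n \<and>
      (\<forall>i. 1 \<le> i \<and> i < length xs \<longrightarrow> 1 \<le> xs ! i \<and> xs ! i < n)}"

definition cpos :: "nat list \<Rightarrow> nat \<Rightarrow> nat list" where
  "cpos v k = (if k = 0 then v else v @ [k])"

definition gedges :: "nat \<Rightarrow> nat \<Rightarrow> nat list set set" where
  "gedges n r =
     {{[k], [(k + 1) mod n]} | k. k < n} \<union>
     {{cpos v k, cpos v ((k + 1) mod n)} | v k. v \<in> gverts n r \<and> length v \<le> r \<and> k < n}"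

end

theory Submission
  imports Defs "HOL-Library.Countable" "HOL-Real_Asymp.Real_Asymp"
begin

text \<open>Work with integer kernel vectors \<open>u - v\<close> of the vertex-edge incidence matrix.  A lasso at a
  vertex \<open>a\<close> is a vector with boundary \<open>2 a\<close>, made of an odd cycle and a doubled path from \<open>a\<close> to it.
  Inside the support of any kernel vector, take a cycle meeting it that is as close to the root as
  possible and follow the support outwards in two directions; this gives two lassos with different
  cycles at the same vertex, whose difference is a kernel vector of small degree.  For a circuit this
  difference must be a multiple of the circuit, which bounds its degree, and one lasso together
  with connectedness of the support forces the index to be 1.

  The large Graver element uses every edge once.  All cycles but the outermost are monochromatic,
  with sign alternating by level, and the outermost odd cycles alternate along the cycle.\<close>

section \<open>Kernel vectors and circuits\<close>

text \<open>No classification of the circuits of a graph enters. A circuit generates the lattice of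
  kernel vectors supported in its support, so any nonzero kernel vector found there has at least the
  degree of the circuit, and it is enough to exhibit one short vector. The constant comes from the
  two lassos: each costs \<open>n\<close> for its odd cycle and 2 per doubled path edge, so half the
  l1 norm of their difference is at most \<open>n\<close> plus the two path lengths. Each path
  passes through at most \<open>r - 1\<close> cycles below the branching cycle, with at most
  \<open>n - 1\<close> edges in each, and one of them also crosses at most \<open>n - 1\<close>
  edges of the branching cycle; hence \<open>(2 * r - 1) * (n - 1)\<close>. Oddness of
  \<open>n\<close> acts three times: an alternating walk round a cycle has boundary
  \<open>2 a\<close>, signs cannot cancel all the way round a cycle, and the outermost colouring
  closes up. Since \<open>tA\<close> is a \<open>Max\<close>, the bound also requires that circuits
  exist. For the failure of polynomial bounds \<open>n = 3\<close> suffices: there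
  \<open>4 * r + 1\<close> stands against a degree of order \<open>2 ^ r\<close>.\<close>

definition bdry :: "('v \<Rightarrow> nat) set \<Rightarrow> (('v \<Rightarrow> nat) \<Rightarrow> int) \<Rightarrow> 'v \<Rightarrow> int" where
  "bdry A g j = (\<Sum>x\<in>A. g x * int (x j))"

definition kernel_vec :: "('v \<Rightarrow> nat) set \<Rightarrow> (('v \<Rightarrow> nat) \<Rightarrow> int) \<Rightarrow> bool" where
  "kernel_vec A g \<longleftrightarrow> (\<forall>x. x \<notin> A \<longrightarrow> g x = 0) \<and> (\<forall>j. bdry A g j = 0)"

definition bdiff :: "('a \<Rightarrow> nat) \<Rightarrow> ('a \<Rightarrow> nat) \<Rightarrow> 'a \<Rightarrow> int" where
  "bdiff u v x = int (u x) - int (v x)"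

definition l1 :: "'a set \<Rightarrow> ('a \<Rightarrow> int) \<Rightarrow> int" where
  "l1 A g = (\<Sum>x\<in>A. \<bar>g x\<bar>)"

lemma bdry_diff: "bdry A (\<lambda>x. g x - h x) j = bdry A g j - bdry A h j"
  by (simp add: bdry_def left_diff_distrib sum_subtractf)

lemma bdry_scale: "bdry A (\<lambda>x. c * g x) j = c * bdry A g j"
  by (simp add: bdry_def sum_distrib_left mult.assoc)

lemma bdry_single:
  assumes "finite A" "e \<in> A"
  shows "bdry A (\<lambda>x. if x = e then c else 0) j = c * int (e j)"
proof -
  have "bdry A (\<lambda>x. if x = e then c else 0) j = (\<Sum>x\<in>A. if x = e then c * int (e j) else 0)"
    unfolding bdry_def by (intro sum.cong) auto
  then show ?thesis using assms by simp
qed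

lemma l1_diff_le: "l1 A (\<lambda>x. g x - h x) \<le> l1 A g + l1 A h"
  unfolding l1_def sum.distrib[symmetric] by (intro sum_mono) auto

lemma l1_single:
  assumes "finite A" "e \<in> A"
  shows "l1 A (\<lambda>x. if x = e then c else 0) = \<bar>c\<bar>"
proof -
  have "l1 A (\<lambda>x. if x = e then c else 0) = (\<Sum>x\<in>A. if x = e then \<bar>c\<bar> else 0)"
    unfolding l1_def by (intro sum.cong) auto
  then show ?thesis using assms by simp
qed

lemma in_toric_outside: "in_toric A u v \<Longrightarrow> x \<notin> A \<Longrightarrow> u x = 0 \<and> v x = 0"
  by (simp add: in_toric_def expvec_def)

lemma in_toric_kernel:
  assumes "in_toric A u v"
  shows "kernel_vec A (bdiff u v)"
proof -
  have "bdry A (bdiff u v) j = 0" for j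
  proof -
    have "bdry A (bdiff u v) j = int (\<Sum>x\<in>A. u x * x j) - int (\<Sum>x\<in>A. v x * x j)"
      by (simp add: bdry_def bdiff_def left_diff_distrib sum_subtractf)
    moreover have "(\<Sum>x\<in>A. u x * x j) = (\<Sum>x\<in>A. v x * x j)"
      using assms unfolding in_toric_def by blast
    ultimately show ?thesis by presburger
  qed
  then show ?thesis using assms by (simp add: kernel_vec_def in_toric_def expvec_def bdiff_def)
qed

lemma kernel_in_toric:
  assumes "expvec A u" "expvec A v" "kernel_vec A (bdiff u v)"
  shows "in_toric A u v"
proof -
  have "(\<Sum>x\<in>A. u x * x j) = (\<Sum>x\<in>A. v x * x j)" for j
  proof -
    have "int (\<Sum>x\<in>A. u x * x j) - int (\<Sum>x\<in>A. v x * x j) = bdry A (bdiff u v) j"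
      by (simp add: bdry_def bdiff_def left_diff_distrib sum_subtractf)
    moreover have "bdry A (bdiff u v) j = 0" using assms(3) unfolding kernel_vec_def by blast
    ultimately show ?thesis by presburger
  qed
  then show ?thesis using assms by (simp add: in_toric_def)
qed

text \<open>\<open>nat\<close> sends negative integers to 0, so the two exponent vectors are the
  positive and the negative part of \<open>g\<close>; this turns kernel vectors back into
  binomials.\<close>

lemma bdiff_nat: "bdiff (\<lambda>x. nat (g x)) (\<lambda>x. nat (- g x)) = g"
  by (auto simp: bdiff_def)

lemma kernel_toric_nat:
  assumes "kernel_vec A g"
  shows "in_toric A (\<lambda>x. nat (g x)) (\<lambda>x. nat (- g x))"
  using assms by (intro kernel_in_toric) (auto simp: bdiff_nat expvec_def kernel_vec_def)

text \<open>Disjointness of the two monomials rules out cancellation in the difference.\<close>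

lemma bsupp_bdiff:
  assumes "in_toric A u v" "irred_binomial u v"
  shows "bsupp A u v = {x. bdiff u v x \<noteq> 0}"
proof -
  have "x \<in> bsupp A u v \<longleftrightarrow> bdiff u v x \<noteq> 0" for x
  proof -
    have "u x = 0 \<or> v x = 0" using assms(2) by (auto simp: irred_binomial_def)
    moreover have "x \<notin> A \<Longrightarrow> u x = 0 \<and> v x = 0"
      using assms(1) by (auto simp: in_toric_def expvec_def)
    ultimately show ?thesis unfolding bsupp_def bdiff_def
      by (cases "x \<in> A") auto
  qed
  then show ?thesis by blast
qed

lemma circuit_minimal:
  assumes "circuit A u v" "kernel_vec A g" "{x. g x \<noteq> 0} \<subset> {x. bdiff u v x \<noteq> 0}"
  shows "g = (\<lambda>x. 0)"
proof (rule ccontr)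
  assume nz: "g \<noteq> (\<lambda>x. 0)"
  let ?w = "\<lambda>x. nat (g x)" and ?z = "\<lambda>x. nat (- g x)"
  have "in_toric A ?w ?z" using kernel_toric_nat assms(2) by blast
  moreover have "?w \<noteq> ?z"
  proof
    assume "?w = ?z"
    then have "bdiff ?w ?z = (\<lambda>x. 0)" by (auto simp: bdiff_def)
    then show False using nz by (simp only: bdiff_nat)
  qed
  moreover have "bsupp A ?w ?z = {x. g x \<noteq> 0}"
    using assms(2) by (auto simp: bsupp_def kernel_vec_def)
  moreover have "bsupp A u v = {x. bdiff u v x \<noteq> 0}"
    using assms(1) bsupp_bdiff by (auto simp: circuit_def)
  ultimately show False using assms(1,3) unfolding circuit_def by metis
qed

text \<open>Minimal support makes \<open>g\<close> and the circuit proportional over the rationals;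
  coprimality of the exponents makes the ratio an integer.\<close>

lemma circuit_multiple:
  assumes c: "circuit A u v" and k: "kernel_vec A g" and nz: "g \<noteq> (\<lambda>x. 0)"
    and sub: "\<And>x. g x \<noteq> 0 \<Longrightarrow> bdiff u v x \<noteq> 0"
  obtains c where "c \<noteq> 0" "\<And>x. g x = c * bdiff u v x"
proof -
  let ?d = "bdiff u v"
  have kd: "kernel_vec A ?d" using c in_toric_kernel by (auto simp: circuit_def)
  obtain x0 where x0: "g x0 \<noteq> 0" using nz by auto
  then have d0: "?d x0 \<noteq> 0" using sub by auto
  \<comment> \<open>This combination cancels at \<open>x0\<close>, so its support is properly
    smaller than that of the circuit.\<close>
  define h where "h = (\<lambda>x. g x0 * ?d x - ?d x0 * g x)"
  have "kernel_vec A h"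
    using k kd unfolding kernel_vec_def h_def by (simp add: bdry_diff bdry_scale)
  moreover have "{x. h x \<noteq> 0} \<subset> {x. ?d x \<noteq> 0}"
  proof -
    have "{x. h x \<noteq> 0} \<subseteq> {x. ?d x \<noteq> 0}"
    proof
      fix x assume "x \<in> {x. h x \<noteq> 0}"
      then have "?d x \<noteq> 0 \<or> g x \<noteq> 0" by (auto simp: h_def)
      then show "x \<in> {x. ?d x \<noteq> 0}" using sub by blast
    qed
    moreover have "h x0 = 0" by (simp add: h_def)
    ultimately show ?thesis using d0 by blast
  qed
  ultimately have "h = (\<lambda>x. 0)" using circuit_minimal[OF c] by auto
  then have eqn: "g x0 * ?d x = ?d x0 * g x" for x
    by (auto simp: h_def fun_eq_iff)
  define G where "G = gcd (g x0) (?d x0)"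
  have G0: "G \<noteq> 0" using x0 by (simp add: G_def)
  obtain a b where ab: "g x0 = G * a" "?d x0 = G * b" "coprime a b"
    unfolding G_def using x0 gcd_coprime_exists[of "g x0" "?d x0"] by (metis gcd_eq_0_iff mult.commute)
  have adbg: "a * ?d x = b * g x" for x
    using eqn[of x] ab G0 by (metis mult.assoc mult_cancel_left)
  then have bd: "b dvd ?d x" for x
  proof -
    have "b dvd a * ?d x" by (simp add: adbg)
    moreover have "coprime b a" using ab(3) by (simp add: coprime_commute)
    ultimately show ?thesis by (simp add: coprime_dvd_mult_right_iff)
  qed
  \<comment> \<open>The reduced denominator \<open>b\<close> of the ratio divides every exponent, so
    irreducibility leaves only a sign.\<close>
  have "nat \<bar>b\<bar> dvd u x \<and> nat \<bar>b\<bar> dvd v x" for x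
  proof -
    have "u x = 0 \<or> v x = 0" using c by (auto simp: circuit_def irred_binomial_def)
    then show ?thesis using bd[of x] by (auto simp: bdiff_def nat_abs_dvd_iff)
  qed
  then have "nat \<bar>b\<bar> = 1" using c by (auto simp: circuit_def irred_binomial_def)
  then have "b = 1 \<or> b = -1" by linarith
  \<comment> \<open>The ratio is \<open>a / b\<close>, which equals \<open>a * b\<close> because
    \<open>b\<close> is 1 or -1.\<close>
  then have "g x = (a * b) * ?d x" for x
    using adbg[of x] by auto
  moreover have "a * b \<noteq> 0" using ab x0 d0 by auto
  ultimately show ?thesis using that by blast
qed

text \<open>A kernel vector of smallest support size, divided by the gcd of its values, is a
  circuit. This is what makes the set in \<open>tA\<close> nonempty.\<close>

lemma circuit_exists:
  assumes fin: "finite A" and ex: "kernel_vec A g0" "g0 \<noteq> (\<lambda>x. 0)"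
  shows "\<exists>u v. circuit A u v"
proof -
  let ?K = "\<lambda>g. kernel_vec A g \<and> g \<noteq> (\<lambda>x. 0)"
  have finsupp: "finite {x. g x \<noteq> 0}" if "?K g" for g
    by (rule finite_subset[OF _ fin]) (use that in \<open>auto simp: kernel_vec_def\<close>)
  obtain g1 where g1: "?K g1" and min1: "\<And>h. ?K h \<Longrightarrow> card {x. g1 x \<noteq> 0} \<le> card {x. h x \<noteq> 0}"
    using ex ex_has_least_nat[of ?K g0 "\<lambda>g. card {x. g x \<noteq> 0}"] by blast
  define G where "G = Gcd (range g1)"
  have Gd: "G dvd g1 x" for x unfolding G_def by auto
  have G0: "G \<noteq> 0"
  proof
    assume "G = 0"
    then have "g1 = (\<lambda>x. 0)" using Gd by (auto simp only: dvd_0_left_iff)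
    then show False using g1 by blast
  qed
  define g where "g = (\<lambda>x. g1 x div G)"
  have gG: "g1 x = G * g x" for x using Gd by (simp add: g_def)
  have "bdry A g j = 0" for j
  proof -
    have "bdry A g1 j = G * bdry A g j"
      unfolding bdry_scale[symmetric] gG[symmetric] by (rule refl)
    then show ?thesis using g1 G0 by (simp add: kernel_vec_def)
  qed
  then have kg: "kernel_vec A g" using g1 by (auto simp: kernel_vec_def g_def)
  have sg: "{x. g x \<noteq> 0} = {x. g1 x \<noteq> 0}" using gG G0 by auto
  let ?u = "\<lambda>x. nat (g x)" and ?v = "\<lambda>x. nat (- g x)"
  have t: "in_toric A ?u ?v" using kernel_toric_nat kg by blast
  have ne: "?u \<noteq> ?v"
  proof
    assume "?u = ?v"
    then have "bdiff ?u ?v = (\<lambda>x. 0)" by (auto simp: bdiff_def)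
    then have "g x = 0" for x unfolding bdiff_nat by (rule fun_cong)
    then have "g1 = (\<lambda>x. 0)" using gG by auto
    then show False using g1 by blast
  qed
  have irr: "irred_binomial ?u ?v"
    unfolding irred_binomial_def
  proof (intro conjI allI impI)
    fix x show "nat (g x) = 0 \<or> nat (- g x) = 0" by linarith
  next
    fix d assume d: "\<forall>x. d dvd nat (g x) \<and> d dvd nat (- g x)"
    have "int d dvd g x" for x
    proof -
      have "g x = int (nat (g x)) - int (nat (- g x))" by (cases "g x \<ge> 0") simp_all
      moreover have "int d dvd int (nat (g x))" "int d dvd int (nat (- g x))"
        using d unfolding int_dvd_int_iff by blast+
      ultimately show ?thesis using dvd_diff by metis
    qed
    then have "G * int d dvd g1 x" for x by (simp add: gG)
    then have "G * int d dvd G" unfolding G_def by (intro Gcd_greatest) auto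
    then have "G * int d dvd G * 1" by simp
    then have "int d dvd 1" unfolding dvd_mult_cancel_left using G0 by blast
    then show "d = 1" by simp
  qed
  have "\<not> bsupp A w z \<subset> bsupp A ?u ?v" if wz: "in_toric A w z" "w \<noteq> z" for w z
  proof
    assume sub: "bsupp A w z \<subset> bsupp A ?u ?v"
    have "kernel_vec A (bdiff w z)" using wz in_toric_kernel by blast
    moreover have "bdiff w z \<noteq> (\<lambda>x. 0)" using wz(2) by (auto simp: bdiff_def fun_eq_iff)
    ultimately have le: "card {x. g1 x \<noteq> 0} \<le> card {x. bdiff w z x \<noteq> 0}" using min1 by blast
    have "{x. bdiff w z x \<noteq> 0} \<subseteq> bsupp A w z"
    proof
      fix x assume "x \<in> {x. bdiff w z x \<noteq> 0}"
      then have "w x \<noteq> z x" by (auto simp: bdiff_def)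
      then have "w x \<noteq> 0 \<or> z x \<noteq> 0" by metis
      then show "x \<in> bsupp A w z"
        using in_toric_outside[OF wz(1), of x] unfolding bsupp_def by (cases "x \<in> A") simp_all
    qed
    moreover have "bsupp A ?u ?v = {x. g1 x \<noteq> 0}"
      using bsupp_bdiff[OF t irr] unfolding bdiff_nat sg .
    ultimately have "{x. bdiff w z x \<noteq> 0} \<subset> {x. g1 x \<noteq> 0}"
      using sub by (metis subset_psubset_trans)
    then have "card {x. bdiff w z x \<noteq> 0} < card {x. g1 x \<noteq> 0}"
      by (rule psubset_card_mono[OF finsupp[OF g1]])
    then show False using le by linarith
  qed
  then have "circuit A ?u ?v" unfolding circuit_def using t ne irr by blast
  then show ?thesis by blast
qed

section \<open>Edge configurations\<close>

definition vdelta :: "'v \<Rightarrow> 'v \<Rightarrow> int" where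
  "vdelta a j = (if j = a then 1 else 0)"

definition edge_config :: "('v \<Rightarrow> nat) set \<Rightarrow> bool" where
  "edge_config A \<longleftrightarrow> finite A \<and>
     (\<forall>x\<in>A. \<exists>a b. a \<noteq> b \<and> x = (\<lambda>j. if j \<in> {a, b} then 1 else 0))"

lemma edge_config_E:
  assumes "edge_config A" "x \<in> A"
  obtains a b where "a \<noteq> b" "x = (\<lambda>j. if j \<in> {a, b} then 1 else 0)"
    "\<And>j. int (x j) = vdelta a j + vdelta b j"
proof -
  obtain a b where ab: "a \<noteq> b" "x = (\<lambda>j. if j \<in> {a, b} then 1 else 0)"
    using assms by (auto simp: edge_config_def)
  moreover have "int (x j) = vdelta a j + vdelta b j" for j
    using ab by (auto simp: vdelta_def)
  ultimately show ?thesis using that by blast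
qed

lemma edge_config_finite: "edge_config A \<Longrightarrow> finite A"
  by (simp only: edge_config_def)

text \<open>The coordinate type may be infinite; \<open>U\<close> makes it possible to sum over
  coordinates.\<close>

lemma edge_config_support:
  assumes "edge_config A"
  shows "\<exists>U. finite U \<and> (\<forall>x\<in>A. \<forall>j. x j \<noteq> 0 \<longrightarrow> j \<in> U) \<and> (\<forall>x\<in>A. (\<Sum>j\<in>U. x j) = 2)"
proof -
  define U where "U = (\<Union>x\<in>A. {j. x j \<noteq> 0})"
  have supp: "finite {j. x j \<noteq> 0} \<and> (\<Sum>j | x j \<noteq> 0. x j) = 2" if x: "x \<in> A" for x
  proof -
    obtain a b where ab: "a \<noteq> b" "x = (\<lambda>j. if j \<in> {a, b} then 1 else 0)"
      by (rule edge_config_E[OF assms x])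
    then have "{j. x j \<noteq> 0} = {a, b}" by auto
    then show ?thesis using ab by simp
  qed
  have finU: "finite U" unfolding U_def using edge_config_finite[OF assms] supp by (rule_tac finite_UN_I) auto
  have "(\<Sum>j\<in>U. x j) = 2" if x: "x \<in> A" for x
  proof -
    have "(\<Sum>j\<in>U. x j) = (\<Sum>j | x j \<noteq> 0. x j)"
      by (rule sum.mono_neutral_right[OF finU]) (use x in \<open>auto simp: U_def\<close>)
    then show ?thesis using supp[OF x] by simp
  qed
  moreover have "j \<in> U" if "x \<in> A" "x j \<noteq> 0" for x j using that unfolding U_def by blast
  ultimately show ?thesis using finU by blast
qed

text \<open>The coordinates of each vector add up to 2, so the degree of a monomial is half the
  coordinate sum of its image. Consequently the maximum in \<open>bdeg\<close> disappears.\<close>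

lemma toric_homogeneous:
  assumes A: "edge_config A" and t: "in_toric A u v"
  shows "(\<Sum>x\<in>A. u x) = (\<Sum>x\<in>A. v x)"
proof -
  obtain U where U: "\<forall>x\<in>A. (\<Sum>j\<in>U. x j) = 2"
    using edge_config_support[OF A] by blast
  have two: "(\<Sum>j\<in>U. \<Sum>x\<in>A. w x * x j) = 2 * (\<Sum>x\<in>A. w x)" for w :: "('a \<Rightarrow> nat) \<Rightarrow> nat"
  proof -
    have "(\<Sum>j\<in>U. \<Sum>x\<in>A. w x * x j) = (\<Sum>x\<in>A. w x * (\<Sum>j\<in>U. x j))"
      by (subst sum.swap) (simp add: sum_distrib_left)
    also have "\<dots> = 2 * (\<Sum>x\<in>A. w x)" using U by (simp add: sum_distrib_right[symmetric])
    finally show ?thesis .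
  qed
  have "\<forall>j. (\<Sum>x\<in>A. u x * x j) = (\<Sum>x\<in>A. v x * x j)"
    using t unfolding in_toric_def by blast
  then have "(\<Sum>j\<in>U. \<Sum>x\<in>A. u x * x j) = (\<Sum>j\<in>U. \<Sum>x\<in>A. v x * x j)"
    by (simp only:)
  then show ?thesis using two[of u] two[of v] by simp
qed

lemma two_bdeg_eq_sum:
  assumes "edge_config A" "in_toric A u v"
  shows "2 * bdeg A u v = (\<Sum>x\<in>A. u x + v x)"
  using toric_homogeneous[OF assms] by (simp add: bdeg_def sum.distrib)

text \<open>A nonzero integer multiple of the circuit has at least the l1 norm of the circuit, and
  that norm is twice the degree.\<close>

lemma circuit_bdeg_le:
  assumes A: "edge_config A" and c: "circuit A u v" and k: "kernel_vec A g" and nz: "g \<noteq> (\<lambda>x. 0)"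
    and sub: "\<And>x. g x \<noteq> 0 \<Longrightarrow> bdiff u v x \<noteq> 0"
  shows "2 * int (bdeg A u v) \<le> l1 A g"
proof -
  obtain m where m: "m \<noteq> 0" "\<And>x. g x = m * bdiff u v x"
    using circuit_multiple[OF c k nz sub] by blast
  have "int (u x + v x) \<le> \<bar>g x\<bar>" for x
  proof -
    have "u x = 0 \<or> v x = 0" using c by (auto simp: circuit_def irred_binomial_def)
    then have "int (u x + v x) = 1 * \<bar>bdiff u v x\<bar>" by (auto simp: bdiff_def)
    also have "\<dots> \<le> \<bar>m\<bar> * \<bar>bdiff u v x\<bar>" by (rule mult_right_mono) (use m in auto)
    also have "\<dots> = \<bar>g x\<bar>" by (simp add: m abs_mult)
    finally show ?thesis .
  qed
  then have "(\<Sum>x\<in>A. int (u x + v x)) \<le> l1 A g" unfolding l1_def by (rule sum_mono)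
  moreover have "2 * int (bdeg A u v) = (\<Sum>x\<in>A. int (u x + v x))"
    using two_bdeg_eq_sum[OF A, of u v] c unfolding circuit_def of_nat_sum[symmetric]
    by (metis of_nat_mult of_nat_numeral)
  ultimately show ?thesis by linarith
qed

section \<open>Integer spans and the lattice index\<close>

lemma int_spanI:
  assumes "\<And>j. y j = (\<Sum>x\<in>S. c x * int (x j))"
  shows "y \<in> int_span S"
  using assms unfolding int_span_def by auto

lemma int_span_sum:
  assumes "\<And>i. i \<in> I \<Longrightarrow> f i \<in> int_span S"
  shows "(\<lambda>j. \<Sum>i\<in>I. m i * f i j) \<in> int_span S"
proof -
  have "\<forall>i\<in>I. \<exists>c. f i = (\<lambda>j. \<Sum>x\<in>S. c x * int (x j))"
    using assms by (auto simp: int_span_def)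
  then obtain c where c: "\<And>i. i \<in> I \<Longrightarrow> f i = (\<lambda>j. \<Sum>x\<in>S. c i x * int (x j))"
    by metis
  have "(\<Sum>i\<in>I. m i * f i j) = (\<Sum>x\<in>S. (\<Sum>i\<in>I. m i * c i x) * int (x j))" for j
  proof -
    have "(\<Sum>i\<in>I. m i * f i j) = (\<Sum>i\<in>I. \<Sum>x\<in>S. m i * c i x * int (x j))"
      using c by (intro sum.cong) (auto simp: sum_distrib_left mult.assoc)
    also have "\<dots> = (\<Sum>x\<in>S. (\<Sum>i\<in>I. m i * c i x) * int (x j))"
      by (subst sum.swap) (simp add: sum_distrib_right)
    finally show ?thesis .
  qed
  then show ?thesis by (rule int_spanI)
qed

lemma int_span_comb2:
  assumes "f \<in> int_span S" "g \<in> int_span S"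
  shows "(\<lambda>j. a * f j + b * g j) \<in> int_span S"
proof -
  have "(\<lambda>j. \<Sum>i\<in>{True, False}. (if i then a else b) * (if i then f else g) j) \<in> int_span S"
    by (rule int_span_sum) (use assms in auto)
  then show ?thesis by simp
qed

lemma int_span_base:
  assumes "finite S" "x \<in> S"
  shows "(\<lambda>j. int (x j)) \<in> int_span S"
proof -
  have "int (x j) = (\<Sum>y\<in>S. (if y = x then 1 else 0) * int (y j))" for j
  proof -
    have "(\<Sum>y\<in>S. (if y = x then 1 else 0) * int (y j)) = (\<Sum>y\<in>S. if y = x then int (x j) else 0)"
      by (intro sum.cong) auto
    then show ?thesis using assms by simp
  qed
  then show ?thesis by (rule int_spanI)
qed

text \<open>From membership in the real span the index bound draws only this: the support of
  \<open>y\<close> lies within the vertices of \<open>S\<close>.\<close>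

lemma int_span_subset_real:
  assumes "y \<in> real_span_int S" "y j \<noteq> 0"
  obtains x where "x \<in> S" "x j \<noteq> 0"
proof -
  obtain r where "real_of_int (y j) = (\<Sum>x\<in>S. r x * real (x j))"
    using assms(1) by (auto simp: real_span_int_def)
  then have "(\<Sum>x\<in>S. r x * real (x j)) \<noteq> 0" using assms(2) by (metis of_int_eq_0_iff)
  then obtain x where "x \<in> S" "r x * real (x j) \<noteq> 0" by (meson sum.neutral)
  then show ?thesis using that by auto
qed

lemma lattice_index_le_1:
  assumes "real_span_int S \<inter> int_span A \<subseteq> int_span S"
  shows "lattice_index A S \<le> 1"
proof -
  let ?M = "real_span_int S \<inter> int_span A"
  let ?R = "{(y, z). y \<in> ?M \<and> z \<in> ?M \<and> y - z \<in> int_span S}"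
  have "?R = ?M \<times> ?M"
  proof -
    have "y - z \<in> int_span S" if "y \<in> ?M" "z \<in> ?M" for y z
    proof -
      have "(\<lambda>j. 1 * y j + (-1) * z j) \<in> int_span S"
        by (rule int_span_comb2) (use that assms in auto)
      then show ?thesis by (simp add: fun_diff_def)
    qed
    then show ?thesis by auto
  qed
  then have "?M // ?R \<subseteq> {?M}" by (auto simp: quotient_def)
  then have "card (?M // ?R) \<le> card {?M}" by (intro card_mono) auto
  then show ?thesis by (simp add: lattice_index_def)
qed

text \<open>The vertices congruent to \<open>a\<close> modulo the lattice form a union of components of
  the support, and a circuit has connected support, so every vertex of the circuit is congruent to
  \<open>a\<close>; the lattice is therefore the full lattice of vectors with even coordinate sum.\<close>
lemma circuit_index_le_1:
  assumes A: "edge_config A" and c: "circuit A u v"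
    and q: "\<And>x. q x \<noteq> 0 \<Longrightarrow> bdiff u v x \<noteq> 0" "\<And>j. bdry A q j = 2 * vdelta a j"
  shows "lattice_index A (bsupp A u v) \<le> 1"
proof -
  let ?d = "bdiff u v"
  define S where "S = bsupp A u v"
  have Sd: "S = {x. ?d x \<noteq> 0}" unfolding S_def using c bsupp_bdiff unfolding circuit_def by blast
  have kd: "kernel_vec A ?d" using c in_toric_kernel unfolding circuit_def by blast
  have SA: "S \<subseteq> A" by (auto simp: S_def bsupp_def)
  have finA: "finite A" using A by (rule edge_config_finite)
  then have finS: "finite S" using SA finite_subset by blast
  \<comment> \<open>Sums replace differences here: as \<open>2 a\<close> lies in the lattice,
    \<open>b + a\<close> and \<open>b - a\<close> belong to it together.\<close>
  define L where "L = {b. (\<lambda>j. vdelta b j + vdelta a j) \<in> int_span S}"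
  have qS: "q x = 0" if "x \<notin> S" for x using that q(1) Sd by blast
  have two_a: "(\<lambda>j. 2 * vdelta a j) \<in> int_span S"
  proof (rule int_spanI)
    show "2 * vdelta a j = (\<Sum>x\<in>S. q x * int (x j))" for j
      unfolding q(2)[symmetric] bdry_def
      by (rule sum.mono_neutral_right[OF finA SA]) (simp add: qS)
  qed
  then have aL: "a \<in> L" unfolding L_def mult_2 by blast
  have step: "c \<in> L" if bL: "b \<in> L" and x: "x \<in> S" and xj: "\<And>j. int (x j) = vdelta b j + vdelta c j"
    for b c x
  proof -
    \<comment> \<open>For an edge \<open>b + c\<close> one has
      \<open>c + a = (b + c) + 2 a - (b + a)\<close>.\<close>
    have "(\<lambda>j. 1 * int (x j) + 1 * (1 * (2 * vdelta a j) + (-1) * (vdelta b j + vdelta a j))) \<in> int_span S"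
      using bL int_span_base[OF finS x] two_a unfolding L_def by (intro int_span_comb2) auto
    moreover have "(\<lambda>j. 1 * int (x j) + 1 * (1 * (2 * vdelta a j) + (-1) * (vdelta b j + vdelta a j)))
        = (\<lambda>j. vdelta c j + vdelta a j)"
      unfolding xj by auto
    ultimately show ?thesis unfolding L_def by (simp only: mem_Collect_eq)
  qed
  have comp: "\<forall>j. x j \<noteq> 0 \<longrightarrow> j \<in> L" if x: "x \<in> S" and j: "x j \<noteq> 0" "j \<in> L" for x j
  proof -
    obtain b c where "b \<noteq> c" and bc: "x = (\<lambda>j. if j \<in> {b, c} then 1 else 0)"
      "\<And>j. int (x j) = vdelta b j + vdelta c j"
      by (rule edge_config_E[OF A subsetD[OF SA x]]) blast
    have bc': "int (x j) = vdelta c j + vdelta b j" for j using bc(2) by simp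
    have supp: "x i \<noteq> 0 \<Longrightarrow> i = b \<or> i = c" for i using bc(1) by (metis insertE singletonD)
    then have "j = b \<or> j = c" using j by blast
    then have "b \<in> L \<and> c \<in> L" using step[OF _ x bc(2)] step[OF _ x bc'] j(2) by blast
    then show ?thesis using supp by blast
  qed
  \<comment> \<open>The restriction of the circuit to the edges inside \<open>L\<close>. An edge of
    \<open>S\<close> meeting \<open>L\<close> lies inside it, so the boundary is merely restricted
    to \<open>L\<close> and still vanishes.\<close>
  define g where "g = (\<lambda>x. if \<forall>j. x j \<noteq> 0 \<longrightarrow> j \<in> L then ?d x else 0)"
  have "bdry A g j = (if j \<in> L then bdry A ?d j else 0)" for j
  proof (cases "j \<in> L")
    case True
    have "g x * int (x j) = ?d x * int (x j)" for x
    proof (cases "?d x \<noteq> 0 \<and> x j \<noteq> 0")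
      case nz: True
      then have "\<forall>j. x j \<noteq> 0 \<longrightarrow> j \<in> L" using comp[of x j] True Sd by blast
      then show ?thesis by (simp add: g_def)
    next
      case False
      then show ?thesis by (cases "x j = 0") (simp_all add: g_def)
    qed
    then show ?thesis using True by (simp only: bdry_def if_True)
  next
    case False
    then have "g x * int (x j) = 0" for x
    proof (cases "x j = 0")
      case nz: False
      then have "\<not> (\<forall>j. x j \<noteq> 0 \<longrightarrow> j \<in> L)" using False by blast
      then have "g x = 0" unfolding g_def by (rule if_not_P)
      then show ?thesis by simp
    qed simp
    then show ?thesis using False by (simp only: bdry_def if_False sum.neutral_const)
  qed
  then have kg: "kernel_vec A g" using kd unfolding kernel_vec_def g_def by simp
  \<comment> \<open>Some edge of the circuit touches \<open>a\<close>, so the restriction is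
    nonzero, and minimality then makes it the whole circuit.\<close>
  have "bdry A q a \<noteq> 0" unfolding q(2) by (simp add: vdelta_def)
  then obtain x where x: "x \<in> A" "q x * int (x a) \<noteq> 0" unfolding bdry_def by (meson sum.neutral)
  then have "q x \<noteq> 0" and xa: "x a \<noteq> 0" by auto
  then have xS: "x \<in> S" using q(1) Sd by blast
  then have "\<forall>j. x j \<noteq> 0 \<longrightarrow> j \<in> L" "?d x \<noteq> 0" using comp[of x a, OF xS xa aL] xS Sd by blast+
  then have "g x \<noteq> 0" by (simp add: g_def)
  then have "\<not> {x. g x \<noteq> 0} \<subset> {x. ?d x \<noteq> 0}" using circuit_minimal[OF c kg] by metis
  moreover have "?d x = 0 \<Longrightarrow> g x = 0" for x by (simp only: g_def if_cancel)
  then have "{x. g x \<noteq> 0} \<subseteq> {x. ?d x \<noteq> 0}" by blast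
  ultimately have gS: "{x. g x \<noteq> 0} = S" using Sd by blast
  have SL: "j \<in> L" if "x \<in> S" "x j \<noteq> 0" for x j
  proof -
    have "g x \<noteq> 0" using that gS by blast
    then have "\<forall>j. x j \<noteq> 0 \<longrightarrow> j \<in> L" unfolding g_def by metis
    then show ?thesis using that by blast
  qed
  obtain U where U: "finite U" "\<forall>x\<in>A. \<forall>j. x j \<noteq> 0 \<longrightarrow> j \<in> U" "\<forall>x\<in>A. (\<Sum>j\<in>U. x j) = 2"
    using edge_config_support[OF A] by blast
  have "y \<in> int_span S" if y: "y \<in> real_span_int S" "y \<in> int_span A" for y
  proof -
    define W where "W = {j. y j \<noteq> 0}"
    have Wx: "\<exists>x\<in>S. x j \<noteq> 0" if "j \<in> W" for j
    proof -
      have "y j \<noteq> 0" using that by (simp add: W_def)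
      then show ?thesis by (rule int_span_subset_real[OF y(1)]) blast
    qed
    have WL: "W \<subseteq> L" using Wx SL by blast
    have WU: "W \<subseteq> U" using Wx U(2) SA by blast
    then have finW: "finite W" using U(1) finite_subset by blast
    have "even (\<Sum>j\<in>W. y j)"
    proof -
      obtain m where m: "y = (\<lambda>j. \<Sum>x\<in>A. m x * int (x j))" using y(2) unfolding int_span_def by blast
      have "(\<Sum>j\<in>W. y j) = (\<Sum>j\<in>U. y j)"
        by (rule sum.mono_neutral_left[OF U(1) WU]) (simp add: W_def)
      also have "\<dots> = (\<Sum>x\<in>A. m x * int (\<Sum>j\<in>U. x j))"
        unfolding m by (subst sum.swap) (simp add: sum_distrib_left)
      also have "\<dots> = (\<Sum>x\<in>A. m x * 2)" using U(3) by (intro sum.cong) auto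
      finally show ?thesis by (simp add: sum_distrib_right[symmetric])
    qed
    then obtain s where s: "(\<Sum>j\<in>W. y j) = 2 * s" by blast
    \<comment> \<open>With coordinate sum \<open>2 s\<close>, the terms \<open>y b * (b + a)\<close>
      contribute \<open>2 s\<close> copies of \<open>a\<close> too many, and subtracting
      \<open>s * (2 a)\<close> removes them.\<close>
    have "(\<lambda>j. 1 * (\<Sum>b\<in>W. y b * (vdelta b j + vdelta a j)) + (- s) * (2 * vdelta a j)) \<in> int_span S"
      by (rule int_span_comb2[OF int_span_sum two_a]) (use WL in \<open>auto simp: L_def\<close>)
    moreover have "(\<lambda>j. 1 * (\<Sum>b\<in>W. y b * (vdelta b j + vdelta a j)) + (- s) * (2 * vdelta a j)) = y"
    proof
      fix j
      have "(\<Sum>b\<in>W. y b * (vdelta b j + vdelta a j)) = (\<Sum>b\<in>W. y b * vdelta b j) + (\<Sum>b\<in>W. y b) * vdelta a j"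
        by (simp add: distrib_left sum.distrib sum_distrib_right)
      moreover have "(\<Sum>b\<in>W. y b * vdelta b j) = (\<Sum>b\<in>W. if b = j then y j else 0)"
        by (intro sum.cong) (auto simp: vdelta_def)
      moreover have "\<dots> = y j" using finW by (auto simp: W_def)
      ultimately show "1 * (\<Sum>b\<in>W. y b * (vdelta b j + vdelta a j)) + (- s) * (2 * vdelta a j) = y j"
        using s by simp
    qed
    ultimately show ?thesis by (simp only:)
  qed
  then show ?thesis using lattice_index_le_1[of S A] unfolding S_def by blast
qed

section \<open>The graphs \<open>G_r^n\<close>\<close>

text \<open>Cycles are indexed by the vertex at which they are attached, with \<open>[]\<close> for the initial cycle;
  \<open>cyc_pos v k\<close> is the \<open>k\<close>-th vertex of cycle \<open>v\<close>.\<close>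
definition cyc_pos :: "nat list \<Rightarrow> nat \<Rightarrow> nat list" where
  "cyc_pos v k = (if k = 0 \<and> v \<noteq> [] then v else v @ [k])"

definition cycles :: "nat \<Rightarrow> nat \<Rightarrow> nat list set" where
  "cycles n r = {v. length v \<le> r \<and> (v \<noteq> [] \<longrightarrow> hd v < n) \<and>
      (\<forall>i. 1 \<le> i \<and> i < length v \<longrightarrow> 1 \<le> v ! i \<and> v ! i < n)}"

lemma cyc_pos_inj: "cyc_pos v i = cyc_pos v j \<longleftrightarrow> i = j"
  by (auto simp: cyc_pos_def)

lemma cycles_Nil: "[] \<in> cycles n r"
  by (simp add: cycles_def)

text \<open>The tree of cycles: children hang at the vertices of \<open>v\<close>, except at
  position 0 of a later cycle, which is its own attaching vertex.\<close>

lemma cycles_snoc: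
  "v @ [k] \<in> cycles n r \<longleftrightarrow> v \<in> cycles n r \<and> Suc (length v) \<le> r \<and> k < n \<and> (v \<noteq> [] \<longrightarrow> k \<noteq> 0)"
  (is "?L \<longleftrightarrow> ?R")
proof
  assume L: ?L
  show ?R
  proof (cases "v = []")
    case False
    have nth: "1 \<le> (v @ [k]) ! i \<and> (v @ [k]) ! i < n" if "1 \<le> i" "i \<le> length v" for i
      using L that by (simp add: cycles_def)
    have "1 \<le> v ! i \<and> v ! i < n" if "1 \<le> i" "i < length v" for i
      using nth[of i] that by (simp add: nth_append)
    moreover have "1 \<le> k \<and> k < n" using nth[of "length v"] False by (simp add: Suc_le_eq)
    ultimately show ?thesis using L False by (simp add: cycles_def)
  qed (use L in \<open>simp add: cycles_def\<close>)
next
  assume R: ?R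
  then show ?L
  proof (cases "v = []")
    case False
    then have "1 \<le> k" using R by simp
    then have "1 \<le> (v @ [k]) ! i \<and> (v @ [k]) ! i < n" if "1 \<le> i" "i < Suc (length v)" for i
      using R that by (cases "i < length v") (auto simp: cycles_def nth_append less_Suc_eq)
    then show ?thesis using R False by (simp add: cycles_def)
  qed (simp add: cycles_def)
qed

text \<open>One uniform description of the initial and the attached cycles, so that later arguments
  need no separate treatment of level 0.\<close>

lemma gedges_cycles:
  assumes "n \<ge> 3"
  shows "gedges n r = {{cyc_pos v k, cyc_pos v (Suc k mod n)} | v k. v \<in> cycles n r \<and> k < n}"
proof -
  have eq: "v \<in> gverts n r \<and> length v \<le> r \<longleftrightarrow> v \<in> cycles n r \<and> v \<noteq> []" for v
    by (cases v) (auto simp: gverts_def cycles_def)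
  have pos: "cyc_pos v k = cpos v k" if "v \<noteq> []" for v k
    using that by (simp add: cyc_pos_def cpos_def)
  have pos0: "cyc_pos [] k = [k]" for k by (simp add: cyc_pos_def)
  show ?thesis (is "_ = ?R")
  proof (intro equalityI subsetI)
    fix e assume "e \<in> gedges n r"
    then consider k where "k < n" "e = {[k], [(k + 1) mod n]}"
      | v k where "v \<in> gverts n r \<and> length v \<le> r" "k < n" "e = {cpos v k, cpos v ((k + 1) mod n)}"
      unfolding gedges_def by blast
    then show "e \<in> ?R"
    proof cases
      case 1
      then have "e = {cyc_pos [] k, cyc_pos [] (Suc k mod n)}" by (simp add: pos0)
      then show ?thesis using 1 cycles_Nil by blast
    next
      case 2
      then have "e = {cyc_pos v k, cyc_pos v (Suc k mod n)}" using eq[of v] by (simp add: pos)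
      then show ?thesis using 2 eq[of v] by blast
    qed
  next
    fix e assume "e \<in> ?R"
    then obtain v k where vk: "v \<in> cycles n r" "k < n" "e = {cyc_pos v k, cyc_pos v (Suc k mod n)}"
      by blast
    show "e \<in> gedges n r"
    proof (cases "v = []")
      case True
      then have "e = {[k], [(k + 1) mod n]}" using vk by (simp add: pos0)
      then show ?thesis using vk unfolding gedges_def by blast
    next
      case False
      then have "e = {cpos v k, cpos v ((k + 1) mod n)}" using vk by (simp add: pos)
      moreover have "v \<in> gverts n r" "length v \<le> r" using eq[of v] vk False by blast+
      ultimately show ?thesis using vk unfolding gedges_def by blast
    qed
  qed
qed

lemma finite_cycles: "finite (cycles n r)"
proof -
  have "cycles n r \<subseteq> {v. set v \<subseteq> {..<n} \<and> length v \<le> r}"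
  proof
    fix v assume v: "v \<in> cycles n r"
    have "x < n" if x: "x \<in> set v" for x
    proof -
      have "\<exists>i < length v. v ! i = x" using x unfolding in_set_conv_nth .
      then obtain i where i: "i < length v" "v ! i = x" by blast
      show ?thesis
      proof (cases "i = 0")
        case True
        have "v \<noteq> []" using i(1) by (rule_tac notI) simp
        moreover have "hd v = x" using i(2) True hd_conv_nth[OF \<open>v \<noteq> []\<close>] by (simp only:)
        ultimately show ?thesis using v unfolding cycles_def by blast
      next
        case False
        then have "1 \<le> i" by simp
        then show ?thesis using i v unfolding cycles_def by blast
      qed
    qed
    then have "set v \<subseteq> {..<n}" by blast
    then show "v \<in> {v. set v \<subseteq> {..<n} \<and> length v \<le> r}" using v unfolding cycles_def by blast
  qed
  moreover have "finite {v. set v \<subseteq> {..<n} \<and> length v \<le> r}"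
    by (rule finite_lists_length_le) (rule finite_lessThan)
  ultimately show ?thesis by (rule finite_subset)
qed

text \<open>The initial cycle has \<open>n\<close> children and every later one
  \<open>n - 1\<close>, which gives a geometric sum over the levels.\<close>

lemma card_cycles:
  assumes "n \<ge> 2"
  shows "card (cycles n r) = 1 + n * (\<Sum>l<r. (n - 1) ^ l)"
proof -
  define lev where "lev l = {v \<in> cycles n r. length v = l}" for l
  have lev0: "lev 0 = {[]}" using cycles_Nil by (auto simp: lev_def)
  have lev1: "lev 1 = (\<lambda>k. [k]) ` {..<n}" if "1 \<le> r"
  proof -
    have "v \<in> lev 1 \<longleftrightarrow> (\<exists>k<n. v = [k])" for v
    proof -
      have "[k] \<in> cycles n r \<longleftrightarrow> k < n" for k using cycles_snoc[of "[]" k n r] that cycles_Nil by simp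
      then show ?thesis by (auto simp: lev_def length_Suc_conv)
    qed
    then show ?thesis by auto
  qed
  have levSS: "lev (Suc (Suc l)) = (\<lambda>(v, k). v @ [k]) ` (lev (Suc l) \<times> {1..<n})" if "Suc (Suc l) \<le> r" for l
  proof (intro equalityI subsetI)
    fix w assume w: "w \<in> lev (Suc (Suc l))"
    then obtain v k where vk: "w = v @ [k]" by (cases w rule: rev_cases) (auto simp: lev_def)
    have "length v = Suc l" using w vk by (simp add: lev_def)
    moreover have "v @ [k] \<in> cycles n r" using w vk by (simp add: lev_def)
    ultimately have "v \<in> lev (Suc l)" "k \<in> {1..<n}" unfolding cycles_snoc lev_def by auto
    then show "w \<in> (\<lambda>(v, k). v @ [k]) ` (lev (Suc l) \<times> {1..<n})" using vk by force
  next
    fix w assume "w \<in> (\<lambda>(v, k). v @ [k]) ` (lev (Suc l) \<times> {1..<n})"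
    then obtain v k where vk: "w = v @ [k]" "v \<in> lev (Suc l)" "k \<in> {1..<n}" by auto
    then show "w \<in> lev (Suc (Suc l))" using that unfolding lev_def by (auto simp: cycles_snoc)
  qed
  have cl: "card (lev (Suc l)) = n * (n - 1) ^ l" if "Suc l \<le> r" for l
    using that
  proof (induction l)
    case 0
    then have "card (lev 1) = card {..<n}" unfolding lev1[OF 0[unfolded One_nat_def[symmetric]]]
      by (intro card_image) (auto simp: inj_on_def)
    then show ?case by simp
  next
    case (Suc l)
    have "card (lev (Suc (Suc l))) = card (lev (Suc l) \<times> {1..<n})"
      unfolding levSS[OF Suc.prems] by (intro card_image) (auto simp: inj_on_def)
    then show ?case using Suc by (simp add: card_cartesian_product mult.commute mult.left_commute)
  qed
  have fin: "finite (lev l)" for l unfolding lev_def using finite_cycles by simp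
  have "cycles n r = (\<Union>l\<in>{..r}. lev l)" by (auto simp: lev_def cycles_def)
  then have "card (cycles n r) = (\<Sum>l\<le>r. card (lev l))"
    using card_UN_disjoint[of "{..r}" lev] fin by (auto simp: lev_def)
  also have "\<dots> = card (lev 0) + (\<Sum>l<r. card (lev (Suc l)))"
    by (simp add: sum.atMost_shift)
  also have "\<dots> = 1 + (\<Sum>l<r. n * (n - 1) ^ l)" using cl lev0 by simp
  finally show ?thesis by (simp add: sum_distrib_left)
qed

section \<open>Vertices, edges and the balance equation\<close>

text \<open>The injective relabelling \<open>\<phi>\<close> allows coordinates in \<open>nat\<close> as well as in \<open>nat list\<close>.\<close>
locale cactus =
  fixes n r :: nat and \<phi> :: "nat list \<Rightarrow> 'v"
  assumes n_odd: "odd n" and n_ge3: "n \<ge> 3" and inj_phi: "inj \<phi>"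
begin

text \<open>Positions are read modulo \<open>n\<close>, so that a walk past the end of a cycle is
  still indexed by consecutive naturals.\<close>

definition P :: "nat list \<Rightarrow> nat \<Rightarrow> nat list" where
  "P v i = cyc_pos v (i mod n)"

definition Ev :: "nat list \<Rightarrow> nat \<Rightarrow> 'v \<Rightarrow> nat" where
  "Ev v i = (\<lambda>j. if j \<in> {\<phi> (P v i), \<phi> (P v (Suc i))} then 1 else 0)"

definition A :: "('v \<Rightarrow> nat) set" where
  "A = {Ev v i | v i. v \<in> cycles n r \<and> i < n}"

lemma P_mod: "P v (i mod n) = P v i" by (simp add: P_def)

lemma P_Suc_mod: "P v (Suc (i mod n)) = P v (Suc i)" by (simp add: P_def mod_Suc_eq)

lemma Ev_mod: "Ev v (i mod n) = Ev v i" by (simp add: Ev_def P_mod P_Suc_mod)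

lemma P_add: "P v (i + n) = P v i" by (simp add: P_def)

lemma mod_less: "i mod n < n" using n_ge3 by simp

lemma Ev_in_A: "v \<in> cycles n r \<Longrightarrow> Ev v i \<in> A"
  unfolding A_def using Ev_mod mod_less by (metis (mono_tags, lifting) mem_Collect_eq)

lemma Suc_mod_neq: "Suc i mod n \<noteq> i mod n"
  using n_ge3 by (simp add: mod_Suc)

lemma P_neq: "P v i \<noteq> P v (Suc i)"
  using Suc_mod_neq[of i] by (simp add: P_def cyc_pos_inj)

lemma P_eq_iff: "P v i = P v j \<longleftrightarrow> i mod n = j mod n"
  by (simp add: P_def cyc_pos_inj)

lemma P_eq_snoc:
  assumes "k \<noteq> 0 \<or> v = []" "k < n"
  shows "P w i = v @ [k] \<longleftrightarrow> w = v \<and> i mod n = k \<or> w = v @ [k] \<and> i mod n = 0"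
  using assms by (auto simp: P_def cyc_pos_def)

lemma Ev_delta: "int (Ev v i j) = vdelta (\<phi> (P v i)) j + vdelta (\<phi> (P v (Suc i))) j"
  using P_neq[of v i] inj_phi by (auto simp: Ev_def vdelta_def dest: injD)

lemma edge_config_A: "edge_config A"
proof -
  have "A = (\<lambda>(v, i). Ev v i) ` (cycles n r \<times> {..<n})" by (auto simp: A_def)
  then have "finite A" using finite_cycles by simp
  moreover have "\<exists>a b. a \<noteq> b \<and> x = (\<lambda>j. if j \<in> {a, b} then 1 else 0)" if xA: "x \<in> A" for x
  proof -
    obtain v i where x: "x = Ev v i" using xA unfolding A_def by blast
    have "\<phi> (P v i) \<noteq> \<phi> (P v (Suc i))" using P_neq inj_phi by (meson injD)
    then show ?thesis using x unfolding Ev_def by blast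
  qed
  ultimately show ?thesis unfolding edge_config_def by blast
qed

lemma finite_A: "finite A" using edge_config_A by (rule edge_config_finite)

lemma AG_gedges: "AG ((`) \<phi> ` gedges n r) = A"
proof -
  define vec where "vec e = (\<lambda>w. if w \<in> \<phi> ` e then 1 else 0 :: nat)" for e :: "nat list set"
  have eq: "vec {cyc_pos v k, cyc_pos v (Suc k mod n)} = Ev v k" if "k < n" for v k
    using that by (simp add: vec_def Ev_def P_def)
  have AG: "AG ((`) \<phi> ` gedges n r) = vec ` gedges n r"
    unfolding AG_def image_image vec_def ..
  show ?thesis
  proof (intro equalityI subsetI)
    fix x assume "x \<in> AG ((`) \<phi> ` gedges n r)"
    then obtain v k where "x = vec {cyc_pos v k, cyc_pos v (Suc k mod n)}" "v \<in> cycles n r" "k < n"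
      unfolding AG unfolding gedges_cycles[OF n_ge3] by blast
    then have "x = Ev v k" "v \<in> cycles n r" "k < n" by (simp_all only: eq)
    then show "x \<in> A" unfolding A_def by blast
  next
    fix x assume "x \<in> A"
    then obtain v k where vk: "x = Ev v k" "v \<in> cycles n r" "k < n" unfolding A_def by blast
    then have "x = vec {cyc_pos v k, cyc_pos v (Suc k mod n)}" by (simp only: eq)
    moreover have "{cyc_pos v k, cyc_pos v (Suc k mod n)} \<in> gedges n r"
      unfolding gedges_cycles[OF n_ge3] using vk by blast
    ultimately show "x \<in> AG ((`) \<phi> ` gedges n r)" unfolding AG by blast
  qed
qed

text \<open>Every edge has an endpoint one longer than the name of its cycle, and dropping the last
  entry of that endpoint recovers the name. Within a cycle, endpoints determine the edge because
  \<open>n\<close> exceeds 2.\<close>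

lemma Ev_eqD:
  assumes "Ev v i = Ev w j"
  shows "v = w \<and> i mod n = j mod n"
proof -
  have "{\<phi> (P v i), \<phi> (P v (Suc i))} = {x. Ev v i x \<noteq> 0}" for v i by (auto simp: Ev_def)
  then have "\<phi> ` {P v i, P v (Suc i)} = \<phi> ` {P w j, P w (Suc j)}" using assms by simp
  then have eq: "{P v i, P v (Suc i)} = {P w j, P w (Suc j)}"
    unfolding inj_image_eq_iff[OF inj_phi] .
  have vw: "v = w"
  proof -
    have len: "length (P v i) = length v \<or> length (P v i) = Suc (length v)" for v i
      by (simp add: P_def cyc_pos_def)
    have mx: "\<exists>x\<in>{P v i, P v (Suc i)}. length x = Suc (length v)" for v i
    proof (cases "i mod n = 0")
      case True
      then have "Suc i mod n \<noteq> 0" using Suc_mod_neq[of i] by simp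
      then have "length (P v (Suc i)) = Suc (length v)" by (simp add: P_def cyc_pos_def)
      then show ?thesis by blast
    next
      case False
      then have "length (P v i) = Suc (length v)" by (simp add: P_def cyc_pos_def)
      then show ?thesis by blast
    qed
    have pre: "butlast (P v i) = v" if "length (P v i) = Suc (length v)" for v i
    proof (cases "i mod n = 0 \<and> v \<noteq> []")
      case True
      then have "P v i = v" by (simp add: P_def cyc_pos_def)
      then show ?thesis using that by simp
    next
      case False
      then have "P v i = v @ [i mod n]" unfolding P_def cyc_pos_def by (rule if_not_P)
      then show ?thesis by simp
    qed
    have le: "length v \<le> length w" if sets: "{P v i, P v (Suc i)} = {P w j, P w (Suc j)}" for v w i j
    proof -
      obtain x where x: "x \<in> {P v i, P v (Suc i)}" "length x = Suc (length v)" using mx by blast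
      then have "x = P w j \<or> x = P w (Suc j)" using sets by blast
      then have "length x \<le> Suc (length w)" using len[of w j] len[of w "Suc j"]
        by (elim disjE) simp_all
      then show ?thesis using x(2) by simp
    qed
    have lvw: "length v = length w" using le[OF eq] le[OF eq[symmetric]] by simp
    obtain x where x: "x \<in> {P v i, P v (Suc i)}" "length x = Suc (length v)" using mx by blast
    have "butlast x = v" using x pre[of v i] pre[of v "Suc i"] by blast
    moreover have "x = P w j \<or> x = P w (Suc j)" using x(1) eq by blast
    then have "butlast x = w" using x(2) pre[of w j] pre[of w "Suc j"] unfolding lvw by blast
    ultimately show ?thesis by (rule subst)
  qed
  have "cyc_pos v ` {i mod n, Suc i mod n} = cyc_pos v ` {j mod n, Suc j mod n}"
    using eq vw by (simp add: P_def)
  moreover have "inj (cyc_pos v)" by (simp add: inj_on_def cyc_pos_inj)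
  ultimately have "{i mod n, Suc i mod n} = {j mod n, Suc j mod n}" by (simp only: inj_image_eq_iff)
  then have "i mod n = j mod n \<or> i mod n = Suc j mod n \<and> Suc i mod n = j mod n"
    unfolding doubleton_eq_iff by blast
  \<comment> \<open>Swapped endpoints would mean going twice forward and returning, hence
    \<open>n dvd 2\<close>.\<close>
  moreover have "\<not> (i mod n = Suc j mod n \<and> Suc i mod n = j mod n)"
  proof
    assume a: "i mod n = Suc j mod n \<and> Suc i mod n = j mod n"
    have "Suc (Suc j) mod n = Suc (Suc j mod n) mod n" by (simp only: mod_Suc_eq)
    also have "\<dots> = Suc (i mod n) mod n" using a by (simp only:)
    also have "\<dots> = Suc i mod n" by (rule mod_Suc_eq)
    also have "\<dots> = j mod n" using a by (rule conjunct2)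
    finally have "n dvd Suc (Suc j) - j" by (rule mod_eq_dvd_iff_nat[THEN iffD1, rotated]) simp
    then show False using n_ge3 dvd_imp_le[of n 2] by simp
  qed
  ultimately show ?thesis using vw by blast
qed

lemma Ev_inj:
  "Ev v i = Ev w j \<longleftrightarrow> v = w \<and> i mod n = j mod n"
  using Ev_eqD Ev_mod by metis

lemma Ev_cong: "i mod n = j mod n \<Longrightarrow> Ev v i = Ev v j"
  by (simp add: Ev_inj)

lemma Suc_mod_cancel: "Suc i mod n = Suc j mod n \<longleftrightarrow> i mod n = j mod n"
proof -
  have "i mod n < n" "j mod n < n" by (rule mod_less)+
  then show ?thesis by (auto simp: mod_Suc)
qed

lemma P_Suc_snoc: "v = [] \<or> Suc i mod n \<noteq> 0 \<Longrightarrow> P v (Suc i) = v @ [Suc i mod n]"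
  by (auto simp: P_def cyc_pos_def)

lemma child_cycle:
  assumes "v \<in> cycles n r" "v = [] \<or> Suc i mod n \<noteq> 0" "Suc (length v) \<le> r"
  shows "P v (Suc i) \<in> cycles n r"
  using assms mod_less[of "Suc i"] by (auto simp: P_Suc_snoc cycles_snoc)

text \<open>Each vertex is addressed through the cycle in which it is not the attaching vertex. It
  meets two edges there and, below the outermost level, the first and last edge of the cycle
  attached to it.\<close>

lemma balance:
  assumes v: "v \<in> cycles n r" and nt: "v = [] \<or> Suc i mod n \<noteq> 0" and x: "x = P v (Suc i)"
  shows "bdry A g (\<phi> x) = g (Ev v i) + g (Ev v (Suc i)) +
    (if Suc (length v) \<le> r then g (Ev x 0) + g (Ev x (n - 1)) else 0)"
proof -
  define k where "k = Suc i mod n"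
  have k: "k < n" "k \<noteq> 0 \<or> v = []" using nt mod_less unfolding k_def by blast+
  have xk: "x = v @ [k]" using P_Suc_snoc[OF nt] x k_def by simp
  define B where "B = {Ev v i, Ev v (Suc i)} \<union> (if Suc (length v) \<le> r then {Ev x 0, Ev x (n - 1)} else {})"
  have xc: "x \<in> cycles n r" if "Suc (length v) \<le> r" using child_cycle[OF v nt that] x by simp
  have P0: "P x 0 = x" "P x (Suc (n - 1)) = x" using n_ge3 xk by (simp_all add: P_def cyc_pos_def)
  have BA: "B \<subseteq> A" using Ev_in_A v xc by (auto simp: B_def)
  have one: "a (\<phi> x) = 1" if "a \<in> B" for a
  proof -
    have "a = Ev v i \<or> a = Ev v (Suc i) \<or> a = Ev x 0 \<or> a = Ev x (n - 1)"
      using that by (auto simp: B_def split: if_splits)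
    then show ?thesis using x P0 by (auto simp: Ev_def)
  qed
  have zero: "a (\<phi> x) = 0" if a: "a \<in> A - B" for a
  proof (rule ccontr)
    assume nz: "a (\<phi> x) \<noteq> 0"
    obtain w j where wj: "a = Ev w j" "w \<in> cycles n r" using a unfolding A_def by blast
    have xr: "Suc (length v) \<le> r" if "w = x" using that wj(2) xk by (simp add: cycles_def)
    have "\<phi> x = \<phi> (P w j) \<or> \<phi> x = \<phi> (P w (Suc j))" using nz wj by (auto simp: Ev_def split: if_splits)
    then have "P w j = x \<or> P w (Suc j) = x" using inj_phi by (metis injD)
    then have "w = v \<and> j mod n = k \<or> w = x \<and> j mod n = 0 \<or> w = v \<and> Suc j mod n = k \<or> w = x \<and> Suc j mod n = 0"
      unfolding xk P_eq_snoc[OF k(2,1)] by blast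
    moreover have "a \<in> B" if "w = v" "j mod n = k"
      using that wj Ev_cong[of j "Suc i" v] k_def by (simp add: B_def)
    moreover have "a \<in> B" if "w = x" "j mod n = 0"
      using that wj Ev_cong[of j 0 x] xr by (simp add: B_def)
    moreover have "a \<in> B" if "w = v" "Suc j mod n = k"
      using that wj Ev_cong[of j i v] k_def Suc_mod_cancel[of j i] by (simp add: B_def)
    moreover have "a \<in> B" if "w = x" "Suc j mod n = 0"
      using that wj Ev_cong[of j "n - 1" x] xr Suc_mod_cancel[of j "n - 1"] n_ge3 by (simp add: B_def)
    ultimately show False using a by blast
  qed
  have "bdry A g (\<phi> x) = (\<Sum>a\<in>B. g a * int (a (\<phi> x)))"
    unfolding bdry_def by (rule sum.mono_neutral_right[OF finite_A BA]) (simp add: zero)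
  also have "\<dots> = (\<Sum>a\<in>B. g a)"
    by (rule sum.cong[OF refl]) (simp only: one of_nat_1 mult_1_right)
  also have "\<dots> = g (Ev v i) + g (Ev v (Suc i)) +
    (if Suc (length v) \<le> r then g (Ev x 0) + g (Ev x (n - 1)) else 0)"
  proof -
    have d1: "Ev v i \<noteq> Ev v (Suc i)" using Suc_mod_neq[of i] by (auto simp: Ev_inj)
    have d2: "Ev x 0 \<noteq> Ev x (n - 1)" using n_ge3 by (simp add: Ev_inj)
    have d3: "Ev v a \<noteq> Ev x b" for a b using xk by (simp add: Ev_inj)
    show ?thesis
      using d1 d2 d3 d3[symmetric] by (simp add: B_def)
  qed
  finally show ?thesis .
qed

section \<open>Lassos\<close>

text \<open>A lasso at \<open>a\<close> with cycle \<open>w\<close> and path length at most \<open>k\<close>; the parity condition keeps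
  the difference of two lassos with different cycles from vanishing.\<close>
definition lasso :: "(('v \<Rightarrow> nat) \<Rightarrow> int) \<Rightarrow> nat list \<Rightarrow> nat list \<Rightarrow> nat \<Rightarrow> bool" where
  "lasso g a w k \<longleftrightarrow> (\<exists>q. (\<forall>x. q x \<noteq> 0 \<longrightarrow> g x \<noteq> 0) \<and> (\<forall>j. bdry A q j = 2 * vdelta (\<phi> a) j) \<and>
     l1 A q \<le> int (n + 2 * k) \<and> (\<forall>x. odd (q x) \<longleftrightarrow> (\<exists>i. x = Ev w i)))"

text \<open>Replacing \<open>q\<close> by \<open>2 e - q\<close> moves the boundary from
  \<open>2 a\<close> to \<open>2 (a + b) - 2 a = 2 b\<close>, costs 2 in norm and leaves all
  parities alone, even if \<open>q\<close> already uses \<open>e\<close>.\<close>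

lemma lasso_edge:
  assumes l: "lasso g a w k" and v: "v \<in> cycles n r" and nz: "g (Ev v i) \<noteq> 0"
    and ab: "{a, b} = {P v i, P v (Suc i)}"
  shows "lasso g b w (Suc k)"
proof -
  obtain q where q: "\<And>x. q x \<noteq> 0 \<Longrightarrow> g x \<noteq> 0" "\<And>j. bdry A q j = 2 * vdelta (\<phi> a) j"
    "l1 A q \<le> int (n + 2 * k)" "\<And>x. odd (q x) \<longleftrightarrow> (\<exists>i. x = Ev w i)"
    using l unfolding lasso_def by blast
  define e where "e = Ev v i"
  have eA: "e \<in> A" using Ev_in_A v by (simp add: e_def)
  define q' where "q' = (\<lambda>x. (if x = e then 2 else 0) - q x)"
  have "g x \<noteq> 0" if "q' x \<noteq> 0" for x
  proof (cases "x = e")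
    case True
    then show ?thesis using nz by (simp add: e_def)
  next
    case False
    then show ?thesis using that q(1) by (simp add: q'_def)
  qed
  moreover have "bdry A q' j = 2 * vdelta (\<phi> b) j" for j
  proof -
    have "int (e j) = vdelta (\<phi> a) j + vdelta (\<phi> b) j"
      using ab unfolding e_def Ev_delta doubleton_eq_iff by auto
    then show ?thesis unfolding q'_def bdry_diff bdry_single[OF finite_A eA] q(2) by simp
  qed
  moreover have "l1 A q' \<le> int (n + 2 * Suc k)"
    using l1_diff_le[of A "\<lambda>x. if x = e then 2 else 0" q] l1_single[OF finite_A eA, of 2] q(3)
    unfolding q'_def by simp
  moreover have "odd (q' x) \<longleftrightarrow> (\<exists>i. x = Ev w i)" for x
    unfolding q(4)[symmetric] by (simp add: q'_def)
  ultimately show ?thesis unfolding lasso_def by blast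
qed

lemma lasso_forward:
  assumes "lasso g (P v a) w k" "v \<in> cycles n r" "\<And>i. a \<le> i \<Longrightarrow> i < a + m \<Longrightarrow> g (Ev v i) \<noteq> 0"
  shows "lasso g (P v (a + m)) w (k + m)"
  using assms(3)
proof (induction m)
  case 0
  then show ?case using assms(1) by simp
next
  case (Suc m)
  have "lasso g (P v (a + m)) w (k + m)" using Suc by simp
  then show ?case using lasso_edge[of g "P v (a + m)" w "k + m" v "a + m" "P v (Suc (a + m))"] assms(2) Suc.prems[of "a + m"]
    by simp
qed

lemma lasso_backward:
  assumes "lasso g (P v (a + m)) w k" "v \<in> cycles n r" "\<And>i. a \<le> i \<Longrightarrow> i < a + m \<Longrightarrow> g (Ev v i) \<noteq> 0"
  shows "lasso g (P v a) w (k + m)"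
  using assms(1,3)
proof (induction m arbitrary: k)
  case 0
  then show ?case by simp
next
  case (Suc m)
  have "lasso g (P v (a + m)) w (Suc k)"
    using lasso_edge[of g "P v (Suc (a + m))" w k v "a + m" "P v (a + m)"] assms(2) Suc.prems
    by (simp add: insert_commute)
  then show ?case using Suc.IH[of "Suc k"] Suc.prems(2) by simp
qed

text \<open>Signs alternate along the walk, so after \<open>m\<close> edges the boundary is the
  start minus \<open>(-1) ^ m\<close> times the end; on closing up after an odd number of edges the
  two terms add.\<close>

lemma cycle_lasso:
  assumes v: "v \<in> cycles n r" and nz: "\<And>i. g (Ev v i) \<noteq> 0"
  shows "lasso g (P v i) v 0"
proof -
  have "\<exists>q. (\<forall>j. bdry A q j = vdelta (\<phi> (P v i)) j - (-1) ^ m * vdelta (\<phi> (P v (i + m))) j) \<and>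
     l1 A q \<le> int m \<and> (\<forall>x. q x \<noteq> 0 \<longrightarrow> (\<exists>t<m. x = Ev v (i + t))) \<and>
     (\<forall>x. odd (q x) \<longleftrightarrow> (\<exists>t<m. x = Ev v (i + t)))" if "m \<le> n" for m
    using that
  proof (induction m)
    case 0
    show ?case by (rule exI[of _ "\<lambda>x. 0"]) (simp add: bdry_def l1_def)
  next
    case (Suc m)
    obtain q where q: "\<And>j. bdry A q j = vdelta (\<phi> (P v i)) j - (-1) ^ m * vdelta (\<phi> (P v (i + m))) j"
      "l1 A q \<le> int m" "\<And>x. q x \<noteq> 0 \<Longrightarrow> \<exists>t<m. x = Ev v (i + t)"
      "\<And>x. odd (q x) \<longleftrightarrow> (\<exists>t<m. x = Ev v (i + t))"
      using Suc.IH Suc.prems by (metis Suc_leD)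
    define e where "e = Ev v (i + m)"
    define c :: int where "c = - ((-1) ^ m)"
    have c: "\<bar>c\<bar> = 1" "odd c" by (simp_all add: c_def power_abs)
    have eA: "e \<in> A" using Ev_in_A v by (simp add: e_def)
    \<comment> \<open>Fewer than \<open>n\<close> edges have been walked, so this one is new; its
      coefficient passes from 0 to 1 or -1 and the parity record stays exact.\<close>
    have e_new: "e \<noteq> Ev v (i + t)" if "t < m" for t
    proof
      assume "e = Ev v (i + t)"
      then have "(i + m) mod n = (i + t) mod n" by (simp add: e_def Ev_inj)
      then have "n dvd (i + m) - (i + t)"
        by (rule mod_eq_dvd_iff_nat[THEN iffD1, rotated]) (use that in simp)
      then have "n \<le> m - t" using that dvd_imp_le[of n "m - t"] by simp
      then show False using that Suc.prems by simp
    qed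
    then have qe: "q e = 0" using q(3) by blast
    define q' where "q' = (\<lambda>x. q x - (if x = e then c else 0))"
    have "bdry A q' j = vdelta (\<phi> (P v i)) j - (-1) ^ Suc m * vdelta (\<phi> (P v (i + Suc m))) j" for j
    proof -
      have "int (e j) = vdelta (\<phi> (P v (i + m))) j + vdelta (\<phi> (P v (i + Suc m))) j"
        unfolding e_def Ev_delta add_Suc_right ..
      then show ?thesis
        unfolding q'_def bdry_diff bdry_single[OF finite_A eA] q(1) c_def by (simp add: algebra_simps)
    qed
    moreover have "l1 A q' \<le> int (Suc m)"
      using l1_diff_le[of A q "\<lambda>x. if x = e then c else 0"] l1_single[OF finite_A eA, of c] q(2) c(1)
      unfolding q'_def by simp
    moreover have "\<exists>t<Suc m. x = Ev v (i + t)" if "q' x \<noteq> 0" for x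
    proof (cases "x = e")
      case True
      then show ?thesis unfolding e_def by blast
    next
      case False
      then have "q x \<noteq> 0" using that by (simp add: q'_def)
      then show ?thesis using q(3) less_SucI by blast
    qed
    moreover have "odd (q' x) \<longleftrightarrow> (\<exists>t<Suc m. x = Ev v (i + t))" for x
    proof (cases "x = e")
      case True
      then have "odd (q' x)" using qe c by (simp add: q'_def)
      then show ?thesis using True unfolding e_def by blast
    next
      case False
      then have "odd (q' x) \<longleftrightarrow> (\<exists>t<m. x = Ev v (i + t))" using q(4) by (simp add: q'_def)
      then show ?thesis using False unfolding e_def less_Suc_eq by blast
    qed
    ultimately show ?case by blast
  qed
  from this[of n] obtain q where
    q: "\<And>j. bdry A q j = vdelta (\<phi> (P v i)) j - (-1) ^ n * vdelta (\<phi> (P v (i + n))) j"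
      "l1 A q \<le> int n" "\<And>x. q x \<noteq> 0 \<Longrightarrow> \<exists>t<n. x = Ev v (i + t)"
      "\<And>x. odd (q x) \<longleftrightarrow> (\<exists>t<n. x = Ev v (i + t))" by blast
  have all: "(\<exists>t<n. x = Ev v (i + t)) \<longleftrightarrow> (\<exists>j. x = Ev v j)" for x
  proof
    assume "\<exists>j. x = Ev v j"
    then obtain j where j: "x = Ev v j" by blast
    \<comment> \<open>Modulo \<open>n\<close>, adding \<open>(n - 1) * i\<close> is subtracting
      \<open>i\<close>, without truncated subtraction.\<close>
    define t where "t = (j + (n - 1) * i) mod n"
    have "(i + t) mod n = (i + (j + (n - 1) * i)) mod n" unfolding t_def by (simp add: mod_add_right_eq)
    also have "i + (j + (n - 1) * i) = j + n * i" using n_ge3 by (cases n) simp_all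
    also have "(j + n * i) mod n = j mod n" by simp
    finally have "Ev v (i + t) = Ev v j" by (rule Ev_cong)
    moreover have "t < n" unfolding t_def by (rule mod_less)
    ultimately show "\<exists>t<n. x = Ev v (i + t)" using j by auto
  qed blast
  have "bdry A q j = 2 * vdelta (\<phi> (P v i)) j" for j
    unfolding q(1) P_add using n_odd by simp
  moreover have "g x \<noteq> 0" if "q x \<noteq> 0" for x using q(3)[OF that] nz by blast
  moreover have "l1 A q \<le> int (n + 2 * 0)" using q(2) by simp
  ultimately show ?thesis unfolding lasso_def using q(4) all by blast
qed

section \<open>Finding lassos inside the support of a kernel vector\<close>

lemma child_step:
  assumes g: "kernel_vec A g" and v: "v \<in> cycles n r" and nt: "v = [] \<or> Suc i mod n \<noteq> 0"
    and nz: "g (Ev v i) + g (Ev v (Suc i)) \<noteq> 0" and x: "x = P v (Suc i)"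
  shows "Suc (length v) \<le> r" "x \<in> cycles n r" "length x = Suc (length v)"
    "g (Ev x 0) \<noteq> 0 \<or> g (Ev x (n - 1)) \<noteq> 0"
proof -
  have "bdry A g (\<phi> x) = 0" using g by (simp add: kernel_vec_def)
  \<comment> \<open>What does not cancel between the two edges of \<open>v\<close> must be
    compensated by a child cycle, so the child exists and carries support at its attaching
    vertex.\<close>
  then have b: "g (Ev v i) + g (Ev v (Suc i)) + (if Suc (length v) \<le> r then g (Ev x 0) + g (Ev x (n - 1)) else 0) = 0"
    using balance[OF v nt x, of g] by simp
  then show r: "Suc (length v) \<le> r" using nz by presburger
  show "x \<in> cycles n r" using child_cycle[OF v nt r] x by simp
  show "length x = Suc (length v)" using P_Suc_snoc[OF nt] x by simp
  show "g (Ev x 0) \<noteq> 0 \<or> g (Ev x (n - 1)) \<noteq> 0" using b nz r by presburger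
qed

text \<open>Either \<open>x\<close> is used completely and is itself the cycle, or the used edges
  starting at its attaching vertex stop somewhere and the support continues into the child there.
  Outermost cycles have no children, so the descent ends in a full cycle. The suffix
  \<open>ys\<close> records that this cycle descends from \<open>x\<close>.\<close>

lemma down_lasso:
  assumes g: "kernel_vec A g"
  shows "x \<in> cycles n r \<Longrightarrow> x \<noteq> [] \<Longrightarrow> g (Ev x 0) \<noteq> 0 \<or> g (Ev x (n - 1)) \<noteq> 0 \<Longrightarrow>
    \<exists>ys k. lasso g x (x @ ys) k \<and> k \<le> (r - length x) * (n - 1)"
proof (induction "r - length x" arbitrary: x rule: less_induct)
  case less
  note x = less.prems
  have Px0: "P x 0 = x" using x(2) by (simp add: P_def cyc_pos_def)
  \<comment> \<open>The slack \<open>n - 1\<close> pays for the walk along \<open>x\<close> back to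
    its attaching vertex.\<close>
  have descend: "\<exists>ys k. lasso g (P x (Suc i)) (x @ ys) k \<and> k + (n - 1) \<le> (r - length x) * (n - 1)"
    if nt: "Suc i mod n \<noteq> 0" and nz: "g (Ev x i) + g (Ev x (Suc i)) \<noteq> 0" for i
  proof -
    define y where "y = P x (Suc i)"
    have y: "Suc (length x) \<le> r" "y \<in> cycles n r" "length y = Suc (length x)"
      "g (Ev y 0) \<noteq> 0 \<or> g (Ev y (n - 1)) \<noteq> 0"
      using child_step[OF g x(1) _ nz y_def] nt by blast+
    have "r - length y < r - length x" "y \<noteq> []" using y by auto
    then obtain ys k where k: "lasso g y (y @ ys) k" "k \<le> (r - length y) * (n - 1)"
      using less.hyps[of y] y by blast
    have "y @ ys = x @ (Suc i mod n # ys)" using P_Suc_snoc nt by (simp add: y_def)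
    then have "lasso g (P x (Suc i)) (x @ (Suc i mod n # ys)) k" using k(1) unfolding y_def by simp
    moreover have "k + (n - 1) \<le> (r - length x) * (n - 1)"
    proof -
      have "r - length x = Suc (r - length y)" using y by simp
      then show ?thesis using k(2) by simp
    qed
    ultimately show ?thesis by blast
  qed
  show ?case
  proof (cases "\<forall>i<n. g (Ev x i) \<noteq> 0")
    case True
    then have "g (Ev x i) \<noteq> 0" for i using Ev_mod[of x i] mod_less[of i] by metis
    then have "lasso g (P x 0) x 0" by (rule cycle_lasso[OF x(1)])
    then have "lasso g x (x @ []) 0" using Px0 by simp
    then show ?thesis by blast
  next
    case False
    then obtain z where z: "z < n" "g (Ev x z) = 0" by blast
    consider "g (Ev x 0) \<noteq> 0" | "g (Ev x (n - 1)) \<noteq> 0" using x(3) by blast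
    then show ?thesis
    proof cases
      case 1
      define m where "m = (LEAST m. g (Ev x m) = 0)"
      have m0: "g (Ev x m) = 0" unfolding m_def using z(2) by (rule LeastI)
      have mn: "m < n" using Least_le[of "\<lambda>m. g (Ev x m) = 0" z] z m_def by simp
      have lt: "g (Ev x i) \<noteq> 0" if "i < m" for i using not_less_Least that unfolding m_def by blast
      have "m \<noteq> 0" using 1 m0 by metis
      then obtain i where i: "m = Suc i" using not0_implies_Suc by blast
      have "Suc i mod n \<noteq> 0" using i mn by simp
      moreover have "g (Ev x i) + g (Ev x (Suc i)) \<noteq> 0" using lt[of i] m0 i by simp
      ultimately obtain ys k where k: "lasso g (P x m) (x @ ys) k" "k + (n - 1) \<le> (r - length x) * (n - 1)"
        using descend[of i] i by blast
      have "lasso g (P x 0) (x @ ys) (k + m)"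
        by (rule lasso_backward) (use k(1) x(1) lt in auto)
      moreover have "k + m \<le> (r - length x) * (n - 1)" using k(2) mn by linarith
      ultimately show ?thesis using Px0 by auto
    next
      case 2
      define m where "m = (GREATEST m. m < n \<and> g (Ev x m) = 0)"
      have m0: "m < n \<and> g (Ev x m) = 0" unfolding m_def
        by (rule GreatestI_nat[of _ z n]) (use z in auto)
      have gt: "g (Ev x i) \<noteq> 0" if "m < i" "i < n" for i
      proof
        assume "g (Ev x i) = 0"
        then have "i \<le> m" unfolding m_def by (intro Greatest_le_nat[of _ i n]) (use that in auto)
        then show False using that by simp
      qed
      have "m \<noteq> n - 1" using 2 m0 by metis
      then have mn: "Suc m < n" using m0 by linarith
      have "Suc m mod n \<noteq> 0" using mn by simp
      moreover have "g (Ev x m) + g (Ev x (Suc m)) \<noteq> 0" using gt[of "Suc m"] m0 mn by simp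
      ultimately obtain ys k where k: "lasso g (P x (Suc m)) (x @ ys) k" "k + (n - 1) \<le> (r - length x) * (n - 1)"
        using descend[of m] by blast
      have "lasso g (P x (Suc m + (n - Suc m))) (x @ ys) (k + (n - Suc m))"
        by (rule lasso_forward[OF k(1) x(1)]) (use gt mn in auto)
      moreover have "P x (Suc m + (n - Suc m)) = x" using mn Px0 P_add[of x 0] by simp
      moreover have "k + (n - Suc m) \<le> (r - length x) * (n - 1)" using k(2) by linarith
      ultimately show ?thesis by auto
    qed
  qed
qed

text \<open>If the topmost cycle \<open>p\<close> is fully used, it serves as one of the two cycles.
  Otherwise a maximal run of used edges on \<open>p\<close> has non-cancelling vertices at both
  ends, and these lead into disjoint subtrees.\<close>

lemma two_lassos:
  assumes g: "kernel_vec A g" and gnz: "g \<noteq> (\<lambda>x. 0)"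
  obtains a w1 w2 k1 k2 where "lasso g a w1 k1" "lasso g a w2 k2" "w1 \<noteq> w2"
    "k1 + k2 \<le> (2 * r - 1) * (n - 1)"
proof -
  let ?Q = "\<lambda>v. v \<in> cycles n r \<and> (\<exists>i. g (Ev v i) \<noteq> 0)"
  obtain x where x: "g x \<noteq> 0" using gnz by blast
  then have "x \<in> A" using g unfolding kernel_vec_def by blast
  then have "\<exists>v. ?Q v" using x unfolding A_def by blast
  then obtain p where Qp: "?Q p" and pmin: "\<And>v. ?Q v \<Longrightarrow> length p \<le> length v"
    using ex_has_least_nat[of ?Q _ length] by blast
  have p: "p \<in> cycles n r" using Qp by blast
  have top: "p = [] \<or> Suc i mod n \<noteq> 0" if nz: "g (Ev p i) + g (Ev p (Suc i)) \<noteq> 0" for i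
  proof (rule ccontr)
    assume "\<not> (p = [] \<or> Suc i mod n \<noteq> 0)"
    then have pne: "p \<noteq> []" and i0: "Suc i mod n = 0" by blast+
    obtain p' k where p': "p = p' @ [k]" using pne by (cases p rule: rev_cases) auto
    have k: "p' \<in> cycles n r" "Suc (length p') \<le> r" "k < n" "p' = [] \<or> k \<noteq> 0"
      using p unfolding p' cycles_snoc by blast+
    have sk: "Suc (k + n - 1) = k + n" using n_ge3 by simp
    have nt: "p' = [] \<or> Suc (k + n - 1) mod n \<noteq> 0" unfolding sk using k by simp
    have Pp: "p = P p' (Suc (k + n - 1))" using P_Suc_snoc[OF nt] unfolding sk using k p' by simp
    have z: "g (Ev p' j) = 0" for j using pmin[of p'] k(1) p' by auto
    have "bdry A g (\<phi> p) = 0" using g by (simp add: kernel_vec_def)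
    then have "g (Ev p 0) + g (Ev p (n - 1)) = 0" using balance[OF k(1) nt Pp, of g] k(2) z by simp
    moreover have "Ev p (Suc i) = Ev p 0" by (rule Ev_cong) (simp add: i0)
    moreover have "Ev p i = Ev p (n - 1)"
      by (rule Ev_cong) (use i0 Suc_mod_cancel[of i "n - 1"] n_ge3 in simp)
    ultimately show False using nz by simp
  qed
  have branch: "\<exists>ys k. lasso g (P p (Suc i)) (P p (Suc i) @ ys) k \<and> k \<le> (r - Suc (length p)) * (n - 1) \<and>
      Suc (length p) \<le> r \<and> length (P p (Suc i)) = Suc (length p)"
    if nz: "g (Ev p i) + g (Ev p (Suc i)) \<noteq> 0" for i
  proof -
    define y where "y = P p (Suc i)"
    have y: "Suc (length p) \<le> r" "y \<in> cycles n r" "length y = Suc (length p)"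
      "g (Ev y 0) \<noteq> 0 \<or> g (Ev y (n - 1)) \<noteq> 0"
      using child_step[OF g p top[OF nz] nz y_def] by blast+
    then have "y \<noteq> []" by auto
    then have "\<exists>ys k. lasso g y (y @ ys) k \<and> k \<le> (r - length y) * (n - 1)"
      using down_lasso[OF g y(2)] y(4) by blast
    then show ?thesis using y(1,3) unfolding y_def by metis
  qed
  show ?thesis
  proof (cases "\<forall>i. g (Ev p i) \<noteq> 0")
    case True
    \<comment> \<open>Cancellation at every vertex would flip the sign an odd number of times round
      the cycle.\<close>
    have "\<exists>i. g (Ev p i) + g (Ev p (Suc i)) \<noteq> 0"
    proof (rule ccontr)
      assume "\<not> ?thesis"
      then have neg: "g (Ev p (Suc i)) = - g (Ev p i)" for i by (metis add_eq_0_iff)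
      have "g (Ev p i) = (-1) ^ i * g (Ev p 0)" for i
        by (induction i) (simp_all add: neg)
      from this[of n] have "g (Ev p n) = - g (Ev p 0)" using n_odd by simp
      moreover have "Ev p n = Ev p 0" by (rule Ev_cong) simp
      ultimately show False using True by simp
    qed
    then obtain i where "g (Ev p i) + g (Ev p (Suc i)) \<noteq> 0" by blast
    then obtain ys k where k: "lasso g (P p (Suc i)) (P p (Suc i) @ ys) k" "k \<le> (r - Suc (length p)) * (n - 1)"
      "Suc (length p) \<le> r" "length (P p (Suc i)) = Suc (length p)" using branch by blast
    have "lasso g (P p (Suc i)) p 0" by (rule cycle_lasso[OF p]) (use True in blast)
    moreover have "P p (Suc i) @ ys \<noteq> p"
    proof
      assume "P p (Suc i) @ ys = p"
      then have "length (P p (Suc i)) + length ys = length p" by (metis length_append)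
      then show False using k(4) by simp
    qed
    moreover have "k + 0 \<le> (2 * r - 1) * (n - 1)"
    proof -
      have "(r - Suc (length p)) * (n - 1) \<le> (2 * r - 1) * (n - 1)" by (rule mult_right_mono) simp_all
      then show ?thesis using le_trans[OF k(2)] by (simp only: add_0_right)
    qed
    ultimately show ?thesis using that k(1) by blast
  next
    case False
    then obtain j where j: "g (Ev p j) = 0" by blast
    have per: "Ev p (a + n * b) = Ev p a" for a b by (rule Ev_cong) simp
    obtain i0 where i0: "g (Ev p i0) \<noteq> 0" using Qp by blast
    define i where "i = (LEAST i. j < i \<and> g (Ev p i) \<noteq> 0)"
    have ex_i: "j < i0 + n * Suc j \<and> g (Ev p (i0 + n * Suc j)) \<noteq> 0"
    proof -
      have "1 * Suc j \<le> n * Suc j" by (rule mult_right_mono) (use n_ge3 in simp_all)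
      then have "Suc j \<le> n * Suc j" by (simp only: mult_1)
      then have "j < i0 + n * Suc j" by (intro trans_less_add2 Suc_le_lessD)
      then show ?thesis using i0 unfolding per by blast
    qed
    have i: "j < i \<and> g (Ev p i) \<noteq> 0" unfolding i_def using ex_i by (rule LeastI)
    then obtain i' where i': "i = Suc i'" using less_imp_Suc_add by blast
    have zi': "g (Ev p i') = 0"
    proof (cases "i' = j")
      case False
      then have "j < i'" using i i' by simp
      moreover have "\<not> (j < i' \<and> g (Ev p i') \<noteq> 0)"
      proof -
        have "i' < i" using i' by simp
        then show ?thesis unfolding i_def by (rule not_less_Least)
      qed
      ultimately show ?thesis by blast
    qed (use j in simp)
    define m where "m = (LEAST m. i < m \<and> g (Ev p m) = 0)"
    have ex_m: "i < i' + n * 1 \<and> g (Ev p (i' + n * 1)) = 0" unfolding per using zi' i' n_ge3 by simp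
    have m: "i < m \<and> g (Ev p m) = 0" unfolding m_def using ex_m by (rule LeastI)
    have mle: "m \<le> i' + n * 1" unfolding m_def using ex_m by (rule Least_le)
    have run: "g (Ev p a) \<noteq> 0" if "i \<le> a" "a < m" for a
    proof (cases "a = i")
      case False
      have "\<not> (i < a \<and> g (Ev p a) = 0)" using not_less_Least that(2) unfolding m_def by blast
      then show ?thesis using False that by simp
    qed (use i in simp)
    obtain m' where m': "m = Suc m'" using m less_imp_Suc_add by blast
    have "g (Ev p i') + g (Ev p (Suc i')) \<noteq> 0" using zi' i i' by simp
    then obtain ys1 k1 where l1: "lasso g (P p i) (P p i @ ys1) k1" "k1 \<le> (r - Suc (length p)) * (n - 1)"
      "Suc (length p) \<le> r" "length (P p i) = Suc (length p)" using branch i' by blast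
    have "g (Ev p m') + g (Ev p (Suc m')) \<noteq> 0" using run[of m'] m m' by simp
    then obtain ys2 k2 where l2: "lasso g (P p m) (P p m @ ys2) k2" "k2 \<le> (r - Suc (length p)) * (n - 1)"
      "length (P p m) = Suc (length p)" using branch m' by blast
    have im: "i + (m - i) = m" using m by simp
    have "lasso g (P p (i + (m - i))) (P p m @ ys2) k2" unfolding im by (rule l2(1))
    then have l2': "lasso g (P p i) (P p m @ ys2) (k2 + (m - i))"
      by (rule lasso_backward[OF _ p]) (use run im in auto)
    have "P p i \<noteq> P p m"
    proof
      assume "P p i = P p m"
      then have "m mod n = i mod n" by (simp add: P_eq_iff)
      then have "n dvd m - i" by (rule mod_eq_dvd_iff_nat[THEN iffD1, rotated]) (use m in simp)
      then have "n \<le> m - i" using m dvd_imp_le[of n "m - i"] by simp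
      then show False using mle i' n_ge3 by simp
    qed
    \<comment> \<open>Distinct prefixes of equal length keep the two cycles apart.\<close>
    then have "P p i @ ys1 \<noteq> P p m @ ys2" using l1(4) l2(3) by (metis append_eq_append_conv)
    \<comment> \<open>Two descents of at most \<open>r - 1 - length p\<close> levels, plus the run
      joining their starting points.\<close>
    moreover have "k1 + (k2 + (m - i)) \<le> (2 * r - 1) * (n - 1)"
    proof -
      have "m - i \<le> n - 1" using mle i' by simp
      then have "k1 + (k2 + (m - i)) \<le> (2 * (r - Suc (length p)) + 1) * (n - 1)"
        using l1(2) l2(2) by (simp add: distrib_right mult_2)
      also have "\<dots> \<le> (2 * r - 1) * (n - 1)" by (rule mult_right_mono) (use l1(3) in simp_all)
      finally show ?thesis .
    qed
    ultimately show ?thesis using that l1(1) l2' by blast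
  qed
qed

section \<open>The bound on true degrees\<close>

lemma circuit_true_degree_le:
  assumes c: "circuit A u v"
  shows "true_degree A u v \<le> n + (2 * r - 1) * (n - 1)"
proof -
  let ?d = "bdiff u v"
  have t: "in_toric A u v" "u \<noteq> v" using c unfolding circuit_def by blast+
  have kd: "kernel_vec A ?d" using in_toric_kernel[OF t(1)] .
  have dnz: "?d \<noteq> (\<lambda>x. 0)"
  proof
    assume "?d = (\<lambda>x. 0)"
    then have "?d x = 0" for x by (rule fun_cong)
    then have "u x = v x" for x by (simp add: bdiff_def)
    then show False using t(2) by blast
  qed
  obtain a w1 w2 k1 k2 where l: "lasso ?d a w1 k1" "lasso ?d a w2 k2" "w1 \<noteq> w2"
    "k1 + k2 \<le> (2 * r - 1) * (n - 1)"
    by (rule two_lassos[OF kd dnz])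
  obtain q1 where q1: "\<And>x. q1 x \<noteq> 0 \<Longrightarrow> ?d x \<noteq> 0" "\<And>j. bdry A q1 j = 2 * vdelta (\<phi> a) j"
    "l1 A q1 \<le> int (n + 2 * k1)" "\<And>x. odd (q1 x) \<longleftrightarrow> (\<exists>i. x = Ev w1 i)"
    using l(1) unfolding lasso_def by blast
  obtain q2 where q2: "\<And>x. q2 x \<noteq> 0 \<Longrightarrow> ?d x \<noteq> 0" "\<And>j. bdry A q2 j = 2 * vdelta (\<phi> a) j"
    "l1 A q2 \<le> int (n + 2 * k2)" "\<And>x. odd (q2 x) \<longleftrightarrow> (\<exists>i. x = Ev w2 i)"
    using l(2) unfolding lasso_def by blast
  define q where "q = (\<lambda>x. q1 x - q2 x)"
  have qd: "?d x \<noteq> 0" if "q x \<noteq> 0" for x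
  proof -
    have "q1 x \<noteq> 0 \<or> q2 x \<noteq> 0" using that by (auto simp: q_def)
    then show ?thesis using q1(1) q2(1) by blast
  qed
  have kq: "kernel_vec A q"
    unfolding kernel_vec_def
  proof (intro conjI allI impI)
    fix x assume "x \<notin> A"
    then have "?d x = 0" using kd unfolding kernel_vec_def by blast
    then show "q x = 0" using qd by blast
  next
    fix j show "bdry A q j = 0" unfolding q_def bdry_diff q1(2) q2(2) by simp
  qed
  \<comment> \<open>On the cycle \<open>w1\<close> the first lasso is odd and the second even, so
    the difference cannot vanish there.\<close>
  have "odd (q1 (Ev w1 0))" using q1(4) by blast
  moreover have "even (q2 (Ev w1 0))"
  proof (rule ccontr)
    assume "odd (q2 (Ev w1 0))"
    then obtain i where "Ev w1 0 = Ev w2 i" using q2(4) by blast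
    then show False using l(3) by (simp add: Ev_inj)
  qed
  ultimately have "q (Ev w1 0) \<noteq> 0" unfolding q_def by (metis eq_iff_diff_eq_0)
  then have qnz: "q \<noteq> (\<lambda>x. 0)" by metis
  have "2 * int (bdeg A u v) \<le> l1 A q"
    by (rule circuit_bdeg_le[OF edge_config_A c kq qnz qd])
  also have "\<dots> \<le> l1 A q1 + l1 A q2" unfolding q_def by (rule l1_diff_le)
  finally have "bdeg A u v \<le> n + (2 * r - 1) * (n - 1)" using q1(3) q2(3) l(4) by linarith
  \<comment> \<open>One of the lassos is reused to place \<open>2 a\<close> in the lattice of the
    circuit.\<close>
  moreover have "lattice_index A (bsupp A u v) \<le> 1"
    by (rule circuit_index_le_1[OF edge_config_A c q1(1,2)])
  ultimately have "bdeg A u v * lattice_index A (bsupp A u v) \<le> (n + (2 * r - 1) * (n - 1)) * 1"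
    by (rule mult_le_mono)
  then show ?thesis by (simp add: true_degree_def)
qed

text \<open>\<open>Max\<close> says something only about finite nonempty sets: finiteness follows
  from the bound itself, nonemptiness from the given circuit.\<close>

lemma tA_le:
  assumes "circuit A u v"
  shows "tA A \<le> n + (2 * r - 1) * (n - 1)"
proof -
  let ?T = "{true_degree A u v | u v. circuit A u v}"
  have le: "t \<le> n + (2 * r - 1) * (n - 1)" if "t \<in> ?T" for t
    using that circuit_true_degree_le by blast
  then have "finite ?T" by (meson finite_nat_set_iff_bounded_le)
  moreover have "?T \<noteq> {}" using assms by blast
  ultimately have "Max ?T \<in> ?T" by (rule Max_in)
  then show ?thesis using le unfolding tA_def by blast
qed

section \<open>The Graver element of exponential degree\<close>

text \<open>The attaching vertex forces the two adjacent edges of an outermost cycle to have equal colour,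
  which is consistent with alternation because \<open>n\<close> is odd.\<close>
definition colour :: "nat list \<Rightarrow> nat \<Rightarrow> bool" where
  "colour v i \<longleftrightarrow> even (length v + (if length v = r then i mod n else 0))"

definition gu :: "('v \<Rightarrow> nat) \<Rightarrow> nat" where
  "gu a = (if \<exists>v i. v \<in> cycles n r \<and> a = Ev v i \<and> colour v i then 1 else 0)"

definition gv :: "('v \<Rightarrow> nat) \<Rightarrow> nat" where
  "gv a = (if \<exists>v i. v \<in> cycles n r \<and> a = Ev v i \<and> \<not> colour v i then 1 else 0)"

definition csgn :: "nat list \<Rightarrow> nat \<Rightarrow> int" where
  "csgn v i = (if colour v i then 1 else -1)"

lemma colour_mod: "i mod n = j mod n \<Longrightarrow> colour v i = colour v j"
  by (simp add: colour_def)

lemma gu_Ev: "v \<in> cycles n r \<Longrightarrow> gu (Ev v i) = (if colour v i then 1 else 0)"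
  unfolding gu_def Ev_inj using colour_mod by metis

lemma gv_Ev: "v \<in> cycles n r \<Longrightarrow> gv (Ev v i) = (if colour v i then 0 else 1)"
  unfolding gv_def Ev_inj using colour_mod by metis

lemma gu_gv_outside:
  assumes "a \<notin> A"
  shows "gu a = 0" "gv a = 0"
  unfolding gu_def gv_def using assms Ev_in_A by metis+

text \<open>With \<open>r \<ge> 1\<close> the initial cycle is not outermost, so alternation is
  never asked for across the wraparound at position 0.\<close>

lemma colour_step:
  assumes "v = [] \<or> Suc i mod n \<noteq> 0" "r \<ge> 1"
  shows "colour v (Suc i) \<longleftrightarrow> (if length v = r then \<not> colour v i else colour v i)"
proof (cases "length v = r")
  case True
  then have "Suc i mod n \<noteq> 0" using assms by auto
  then have "Suc i mod n = Suc (i mod n)" by (simp add: mod_Suc split: if_splits)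
  then show ?thesis using True by (simp add: colour_def)
qed (simp add: colour_def)

lemma colour_ends: "colour v (n - 1) = colour v 0" "colour v 0 = even (length v)"
proof -
  have "even (n - 1)" using n_odd by simp
  moreover have "(n - 1) mod n = n - 1" using n_ge3 by simp
  ultimately show "colour v (n - 1) = colour v 0" "colour v 0 = even (length v)"
    by (simp_all add: colour_def)
qed

text \<open>An attaching vertex is a non-attaching vertex of the parent cycle, so a coordinate not
  of the given form lies off the graph.\<close>

lemma bdry_other:
  assumes "\<And>v i. v \<in> cycles n r \<Longrightarrow> v = [] \<or> Suc i mod n \<noteq> 0 \<Longrightarrow> j \<noteq> \<phi> (P v (Suc i))"
  shows "bdry A g j = 0"
proof -
  have no: "j \<noteq> \<phi> (P v i)" if v: "v \<in> cycles n r" for v i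
  proof (cases "v = [] \<or> i mod n \<noteq> 0")
    case True
    have "Suc (i + n - 1) = i + n" using n_ge3 by simp
    moreover have "v = [] \<or> (i + n) mod n \<noteq> 0" using True by simp
    ultimately have "j \<noteq> \<phi> (P v (i + n))" using assms[OF v, of "i + n - 1"] by simp
    then show ?thesis unfolding P_add .
  next
    case False
    then have "v \<noteq> []" and Pv: "P v i = v" by (auto simp: P_def cyc_pos_def)
    then obtain p k where p: "v = p @ [k]" by (cases v rule: rev_cases) auto
    then have k: "p \<in> cycles n r" "k < n" "p = [] \<or> k \<noteq> 0"
      using v unfolding p cycles_snoc by blast+
    have sk: "Suc (k + n - 1) = k + n" using n_ge3 by simp
    have nt: "p = [] \<or> Suc (k + n - 1) mod n \<noteq> 0" unfolding sk using k by simp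
    have vp: "v = P p (Suc (k + n - 1))" using P_Suc_snoc[OF nt] unfolding sk using k p by simp
    have "j \<noteq> \<phi> (P p (Suc (k + n - 1)))" by (rule assms[OF k(1) nt])
    then show ?thesis unfolding Pv vp[symmetric] .
  qed
  have "a j = 0" if a: "a \<in> A" for a
  proof -
    obtain v i where "a = Ev v i" "v \<in> cycles n r" using a unfolding A_def by blast
    then show ?thesis using no by (simp add: Ev_def)
  qed
  then show ?thesis unfolding bdry_def by (simp add: sum.neutral)
qed

lemma kernel_vecI:
  assumes "\<And>x. x \<notin> A \<Longrightarrow> g x = 0"
    and "\<And>v i. v \<in> cycles n r \<Longrightarrow> v = [] \<or> Suc i mod n \<noteq> 0 \<Longrightarrow> bdry A g (\<phi> (P v (Suc i))) = 0"
  shows "kernel_vec A g"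
  unfolding kernel_vec_def
proof (intro conjI allI impI)
  fix j
  show "bdry A g j = 0"
  proof (rule ccontr)
    assume nz: "bdry A g j \<noteq> 0"
    show False using bdry_other[of j g] assms(2) nz by metis
  qed
qed (rule assms(1))

text \<open>At an inner vertex two equal signs of one level meet two opposite signs of the next; at
  an outermost vertex the two signs alternate.\<close>

lemma graver_toric:
  assumes "r \<ge> 1"
  shows "in_toric A gu gv"
proof (rule kernel_in_toric)
  have d: "bdiff gu gv (Ev v i) = csgn v i" if "v \<in> cycles n r" for v i
    using gu_Ev[OF that, of i] gv_Ev[OF that, of i] by (simp add: bdiff_def csgn_def)
  show "kernel_vec A (bdiff gu gv)"
  proof (rule kernel_vecI)
    fix v i assume v: "v \<in> cycles n r" and nt: "v = [] \<or> Suc i mod n \<noteq> 0"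
    define x where "x = P v (Suc i)"
    have b: "bdry A (bdiff gu gv) (\<phi> x) = bdiff gu gv (Ev v i) + bdiff gu gv (Ev v (Suc i)) +
       (if Suc (length v) \<le> r then bdiff gu gv (Ev x 0) + bdiff gu gv (Ev x (n - 1)) else 0)"
      by (rule balance[OF v nt x_def])
    have lv: "length v \<le> r" using v by (simp add: cycles_def)
    have "bdry A (bdiff gu gv) (\<phi> x) = 0"
    proof (cases "length v = r")
      case True
      then show ?thesis unfolding b d[OF v] using colour_step[OF nt assms] by (simp add: csgn_def)
    next
      case False
      then have lt: "Suc (length v) \<le> r" using lv by simp
      have x: "x \<in> cycles n r" using child_cycle[OF v nt lt] by (simp add: x_def)
      have lx: "length x = Suc (length v)" using P_Suc_snoc[OF nt] by (simp add: x_def)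
      have "colour v i \<longleftrightarrow> even (length v)" using False by (simp add: colour_def)
      then show ?thesis unfolding b d[OF v] d[OF x]
        using lt False colour_step[OF nt assms] lx by (simp add: csgn_def colour_ends del: One_nat_def)
    qed
    then show "bdry A (bdiff gu gv) (\<phi> (P v (Suc i))) = 0" by (simp add: x_def)
  qed (simp add: bdiff_def gu_gv_outside)
qed (simp_all add: expvec_def gu_gv_outside)

text \<open>Balance at the vertices of a cycle ties the usage of its edges to that of the child cycles;
  working from the outermost cycles inwards, every cycle is used completely or not at all, and
  consistently with its parent.\<close>
lemma sub_binomial_constant:
  assumes r: "r \<ge> 1" and h: "kernel_vec A h"
    and hc: "\<And>v i. v \<in> cycles n r \<Longrightarrow> h (Ev v i) = csgn v i * t v i"
    and t01: "\<And>v i. v \<in> cycles n r \<Longrightarrow> t v i = 0 \<or> t v i = (1::int)"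
    and v: "v \<in> cycles n r"
  shows "t v i = t [] 0"
proof -
  have tmod: "t v i = t v j" if "v \<in> cycles n r" "i mod n = j mod n" for v i j
    using hc[OF that(1), of i] hc[OF that(1), of j] Ev_cong[OF that(2), of v] colour_mod[OF that(2), of v]
    by (auto simp: csgn_def split: if_splits)
  \<comment> \<open>Walking from position 0 to \<open>n - 1\<close> crosses only non-attaching
    vertices.\<close>
  have step_const: "t v i = t v j"
    if v: "v \<in> cycles n r" and s: "\<And>i. v = [] \<or> Suc i mod n \<noteq> 0 \<Longrightarrow> t v i = t v (Suc i)" for v i j
  proof -
    have "t v i = t v 0" if "i < n" for i
      using that
    proof (induction i)
      case (Suc i)
      then show ?case using s[of i] by simp
    qed simp
    then have "t v (i mod n) = t v (j mod n)" for i j using mod_less by metis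
    then show ?thesis using tmod[OF v, of i "i mod n"] tmod[OF v, of j "j mod n"] by simp
  qed
  have bal: "h (Ev v i) + h (Ev v (Suc i)) +
       (if Suc (length v) \<le> r then h (Ev x 0) + h (Ev x (n - 1)) else 0) = 0"
    if "v \<in> cycles n r" "v = [] \<or> Suc i mod n \<noteq> 0" "x = P v (Suc i)" for v i x
    using balance[OF that, of h] h by (simp add: kernel_vec_def)
  have link: "t v i = t v (Suc i) \<and> (Suc (length v) \<le> r \<longrightarrow> t (P v (Suc i)) 0 = t v i)"
    if v: "v \<in> cycles n r" and nt: "v = [] \<or> Suc i mod n \<noteq> 0"
      and ch: "Suc (length v) \<le> r \<Longrightarrow> t (P v (Suc i)) 0 = t (P v (Suc i)) (n - 1)" for v i
  proof -
    define x where "x = P v (Suc i)"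
    have lv: "length v \<le> r" using v by (simp add: cycles_def)
    show ?thesis
    proof (cases "length v = r")
      case True
      then show ?thesis using bal[OF v nt x_def] colour_step[OF nt r] hc[OF v]
        by (auto simp: csgn_def split: if_splits)
    next
      case False
      then have lt: "Suc (length v) \<le> r" using lv by simp
      have x: "x \<in> cycles n r" using child_cycle[OF v nt lt] by (simp add: x_def)
      have lx: "length x = Suc (length v)" using P_Suc_snoc[OF nt] by (simp add: x_def)
      have cv: "colour v i \<longleftrightarrow> even (length v)" "colour v (Suc i) \<longleftrightarrow> even (length v)"
        using False by (simp_all add: colour_def)
      define s where "s = csgn v i"
      have s: "csgn v i = s" "csgn v (Suc i) = s" "csgn x 0 = - s" "csgn x (n - 1) = - s" "s \<noteq> 0"
        using cv lx unfolding s_def csgn_def by (simp_all add: colour_ends del: One_nat_def)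
      \<comment> \<open>Balance makes the value on the child the average of two neighbouring values.
        Since all of them are 0 or 1, they coincide.\<close>
      have "s * t v i + s * t v (Suc i) + (- s * t x 0 + - s * t x 0) = 0"
        using bal[OF v nt x_def] lt ch[OF lt] unfolding hc[OF v] hc[OF x] s by (simp add: x_def)
      then have "s * (t v i + t v (Suc i) - 2 * t x 0) = 0" by (simp add: algebra_simps)
      then have "t v i + t v (Suc i) = 2 * t x 0" using s(5) by simp
      then have "t v i = t x 0 \<and> t v (Suc i) = t x 0"
        using t01[OF v, of i] t01[OF v, of "Suc i"] t01[OF x, of 0] by auto
      then show ?thesis by (simp add: x_def)
    qed
  qed
  have const: "t v i = t v j" if "v \<in> cycles n r" for v i j
    using that
  proof (induction "r - length v" arbitrary: v i j rule: less_induct)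
    case less
    have "t v i = t v (Suc i)" if nt: "v = [] \<or> Suc i mod n \<noteq> 0" for i
    proof -
      have "t (P v (Suc i)) 0 = t (P v (Suc i)) (n - 1)" if lt: "Suc (length v) \<le> r"
      proof -
        have "length (P v (Suc i)) = Suc (length v)" using P_Suc_snoc[OF nt] by simp
        then have "r - length (P v (Suc i)) < r - length v" using lt by simp
        then show ?thesis using less.hyps child_cycle[OF less.prems nt lt] by blast
      qed
      then show ?thesis using link[OF less.prems nt] by blast
    qed
    then show ?case using step_const[OF less.prems] by blast
  qed
  \<comment> \<open>Constancy on each cycle is now carried outwards from the initial cycle through
    the attaching vertices.\<close>
  have "t v 0 = t [] 0"
    using v
  proof (induction v rule: rev_induct)
    case (snoc k p)
    have k: "p \<in> cycles n r" "Suc (length p) \<le> r" "k < n" "p = [] \<or> k \<noteq> 0"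
      using snoc.prems unfolding cycles_snoc by blast+
    have sk: "Suc (k + n - 1) = k + n" using n_ge3 by simp
    have nt: "p = [] \<or> Suc (k + n - 1) mod n \<noteq> 0" unfolding sk using k by simp
    have Pv: "P p (Suc (k + n - 1)) = p @ [k]" using P_Suc_snoc[OF nt] unfolding sk using k by simp
    have "t (p @ [k]) 0 = t p (k + n - 1)"
      using link[OF k(1) nt const] child_cycle[OF k(1) nt k(2)] k(2) unfolding Pv by blast
    also have "\<dots> = t p 0" using const[OF k(1)] .
    finally show ?case using snoc.IH[OF k(1)] by simp
  qed simp
  then show ?thesis using const[OF v, of i 0] by simp
qed

text \<open>A smaller binomial selects a subset of the edges, with indicator \<open>t\<close>. As
  \<open>t\<close> is constant, the selection is empty, contradicting \<open>w \<noteq> z\<close>,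
  or it is everything.\<close>

lemma graver_primitive:
  assumes r: "r \<ge> 1"
  shows "primitive A gu gv"
  unfolding primitive_def
proof (intro conjI allI impI)
  show "in_toric A gu gv" using graver_toric[OF r] .
  have "gu (Ev [] 0) \<noteq> gv (Ev [] 0)" using gu_Ev[OF cycles_Nil] gv_Ev[OF cycles_Nil] by simp
  then show "gu \<noteq> gv" by metis
next
  fix w z
  assume "in_toric A w z \<and> w \<noteq> z \<and> (\<forall>x. w x \<le> gu x) \<and> (\<forall>x. z x \<le> gv x)"
  then have t: "in_toric A w z" and ne: "w \<noteq> z" and w: "\<And>x. w x \<le> gu x" and z: "\<And>x. z x \<le> gv x"
    by blast+
  define t where "t v i = int (w (Ev v i)) + int (z (Ev v i))" for v i
  have wz: "w (Ev v i) = (if colour v i then nat (t v i) else 0)"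
    "z (Ev v i) = (if colour v i then 0 else nat (t v i))" "t v i = 0 \<or> t v i = 1"
    if v: "v \<in> cycles n r" for v i
    using w[of "Ev v i"] z[of "Ev v i"] gu_Ev[OF v, of i] gv_Ev[OF v, of i] unfolding t_def
    by (cases "colour v i"; simp; linarith)+
  have h: "bdiff w z (Ev v i) = csgn v i * t v i" if v: "v \<in> cycles n r" for v i
    using wz[OF v, of i] by (auto simp: bdiff_def csgn_def)
  have const: "t v i = t [] 0" if "v \<in> cycles n r" for v i
    using sub_binomial_constant[OF r in_toric_kernel[OF t], of t v i] h wz(3) that by blast
  have out: "w a = 0" "z a = 0" if "a \<notin> A" for a
    using in_toric_outside[OF t that] by blast+
  have "t [] 0 = 1"
  proof (rule ccontr)
    assume "t [] 0 \<noteq> 1"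
    then have t0: "t v i = 0" if "v \<in> cycles n r" for v i
      using const[OF that, of i] wz(3)[OF cycles_Nil, of 0] by simp
    have "w a = z a" for a
    proof (cases "a \<in> A")
      case True
      then obtain v i where a: "a = Ev v i" "v \<in> cycles n r" unfolding A_def by blast
      then show ?thesis using wz(1,2)[OF a(2), of i] t0[OF a(2), of i] by simp
    qed (simp add: out)
    then show False using ne by blast
  qed
  then have t1: "t v i = 1" if "v \<in> cycles n r" for v i using const[OF that] by simp
  have "w a = gu a \<and> z a = gv a" for a
  proof (cases "a \<in> A")
    case True
    then obtain v i where a: "a = Ev v i" "v \<in> cycles n r" unfolding A_def by blast
    then show ?thesis using wz(1,2)[OF a(2), of i] t1[OF a(2), of i] gu_Ev[OF a(2), of i] gv_Ev[OF a(2), of i]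
      by simp
  qed (simp add: out gu_gv_outside)
  then show "w = gu" "z = gv" by blast+
qed

text \<open>Every edge is used exactly once and the cycles are edge-disjoint, so twice the degree is
  the number of edges.\<close>

lemma graver_degree:
  assumes r: "r \<ge> 1"
  shows "2 * bdeg A gu gv = n * card (cycles n r)"
proof -
  have "gu a + gv a = 1" if aA: "a \<in> A" for a
  proof -
    obtain v i where a: "a = Ev v i" "v \<in> cycles n r" using aA unfolding A_def by blast
    then show ?thesis using gu_Ev[OF a(2), of i] gv_Ev[OF a(2), of i] by simp
  qed
  then have "2 * bdeg A gu gv = card A"
    using two_bdeg_eq_sum[OF edge_config_A graver_toric[OF r]] by simp
  also have "card A = card ((\<lambda>(v, i). Ev v i) ` (cycles n r \<times> {..<n}))"
    unfolding A_def by (rule arg_cong[of _ _ card]) auto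
  also have "\<dots> = card (cycles n r \<times> {..<n})"
    by (rule card_image) (auto simp: inj_on_def Ev_inj)
  finally show ?thesis by (simp add: card_cartesian_product mult.commute)
qed

lemma circuit_ex:
  assumes "r \<ge> 1"
  shows "\<exists>u v. circuit A u v"
proof (rule circuit_exists[OF finite_A])
  show "kernel_vec A (bdiff gu gv)" by (rule in_toric_kernel[OF graver_toric[OF assms]])
  have "bdiff gu gv (Ev [] 0) \<noteq> 0" using gu_Ev[OF cycles_Nil, of 0] gv_Ev[OF cycles_Nil, of 0]
    by (simp add: bdiff_def)
  then show "bdiff gu gv \<noteq> (\<lambda>x. 0)" by metis
qed

lemma graver_degree_real:
  assumes "r \<ge> 1"
  shows "real (bdeg A gu gv) = (real n + real n ^ 2 * ((real n - 1) ^ r - 1) / (real n - 2)) / 2"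
proof -
  have "2 * bdeg A gu gv = n * (1 + n * (\<Sum>l<r. (n - 1) ^ l))"
    using graver_degree[OF assms] card_cycles[of n r] n_ge3 by simp
  then have "2 * real (bdeg A gu gv) = real (n * (1 + n * (\<Sum>l<r. (n - 1) ^ l)))"
    by (metis of_nat_mult of_nat_numeral)
  also have "\<dots> = real n * (1 + real n * (\<Sum>l<r. (real n - 1) ^ l))"
    using n_ge3 by (simp add: of_nat_diff algebra_simps)
  also have "(\<Sum>l<r. (real n - 1) ^ l) = ((real n - 1) ^ r - 1) / (real n - 2)"
    using geometric_sum[of "real n - 1" r] n_ge3 by simp
  finally show ?thesis by (simp add: power2_eq_square field_simps)
qed

lemma graver_basis_element:
  assumes "r \<ge> 1"
  shows "(gu, gv) \<in> graver_basis A"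
  using graver_primitive[OF assms] by (simp add: graver_basis_def)

lemma tA_bound:
  assumes "r \<ge> 1"
  shows "tA A \<le> n + (2 * r - 1) * (n - 1)"
  using circuit_ex[OF assms] tA_le by blast

end

section \<open>Exponential against polynomial growth\<close>

lemma poly_less_exponential:
  fixes p :: "real poly"
  shows "\<exists>r\<ge>1. \<forall>t\<le>4 * r + 1. poly p (real t) < 2 ^ r"
proof -
  define C where "C = (\<Sum>i\<le>degree p. \<bar>coeff p i\<bar>)"
  define d where "d = degree p"
  \<comment> \<open>Only an upper bound on \<open>tA\<close> is available and \<open>p\<close> need
    not be monotone, so \<open>p\<close> is replaced by a monotone majorant.\<close>
  have bound: "poly p x \<le> C * (1 + x) ^ d" if "x \<ge> 0" for x
  proof -
    have "coeff p i * x ^ i \<le> \<bar>coeff p i\<bar> * (1 + x) ^ d" if "i \<le> d" for i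
    proof (rule mult_mono)
      have "x ^ i \<le> (1 + x) ^ i" using \<open>x \<ge> 0\<close> by (intro power_mono) auto
      also have "\<dots> \<le> (1 + x) ^ d" using \<open>x \<ge> 0\<close> that by (intro power_increasing) auto
      finally show "x ^ i \<le> (1 + x) ^ d" .
    qed (use \<open>x \<ge> 0\<close> in auto)
    then show ?thesis
      unfolding poly_altdef C_def sum_distrib_right d_def by (intro sum_mono) simp
  qed
  have C0: "C \<ge> 0" unfolding C_def by (intro sum_nonneg) simp
  have "eventually (\<lambda>r::nat. C * (4 * real r + 2) ^ d < 2 ^ r) at_top" by real_asymp
  then have "eventually (\<lambda>r::nat. C * (4 * real r + 2) ^ d < 2 ^ r \<and> r \<ge> 1) at_top"
    by (rule eventually_conj) (rule eventually_ge_at_top)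
  then obtain r :: nat where r: "C * (4 * real r + 2) ^ d < 2 ^ r" "r \<ge> 1"
    by (auto simp: eventually_at_top_linorder)
  have "poly p (real t) < 2 ^ r" if "t \<le> 4 * r + 1" for t
  proof -
    have "poly p (real t) \<le> C * (1 + real t) ^ d" by (rule bound) simp
    also have "\<dots> \<le> C * (4 * real r + 2) ^ d"
      using C0 that by (intro mult_left_mono power_mono) auto
    finally show ?thesis using r(1) by linarith
  qed
  then show ?thesis using r(2) by blast
qed

lemma graver_degree_not_polynomial:
  fixes p :: "real poly"
  shows "\<exists>(n::nat) (A :: (nat \<Rightarrow> nat) set) u v. finite A \<and> A \<subseteq> {x. \<forall>j\<ge>n. x j = 0} \<and>
    (u, v) \<in> graver_basis A \<and> real (bdeg A u v) > poly p (real (tA A))"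
proof -
  obtain r where r: "r \<ge> 1" "\<And>t. t \<le> 4 * r + 1 \<Longrightarrow> poly p (real t) < 2 ^ r"
    using poly_less_exponential[of p] by blast
  \<comment> \<open>For \<open>n = 3\<close> the bound \<open>n + (2 * r - 1) * (n - 1)\<close> is
    \<open>4 * r + 1\<close>; \<open>to_nat\<close> turns list vertices into natural
    coordinates.\<close>
  interpret cactus 3 r "to_nat :: nat list \<Rightarrow> nat" by unfold_locales simp_all
  obtain U where U: "finite U" "\<forall>x\<in>A. \<forall>j. x j \<noteq> 0 \<longrightarrow> j \<in> U"
    using edge_config_support[OF edge_config_A] by blast
  obtain N where N: "\<forall>j\<in>U. j < N" using U(1) finite_nat_set_iff_bounded by blast
  have sub: "A \<subseteq> {x. \<forall>j\<ge>N. x j = 0}" using U(2) N by (auto simp: not_less[symmetric])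
  have "tA A \<le> 4 * r + 1" using tA_bound[OF r(1)] r(1) by simp
  then have "poly p (real (tA A)) < 2 ^ r" by (rule r(2))
  \<comment> \<open>For \<open>n = 3\<close> the degree is
    \<open>(9 * 2 ^ r - 6) / 2\<close>.\<close>
  also have "(2::real) ^ r \<le> real (bdeg A gu gv)"
  proof -
    have "(1::real) \<le> 2 ^ r" by simp
    then show ?thesis unfolding graver_degree_real[OF r(1)] by (simp, linarith)
  qed
  finally have "real (bdeg A gu gv) > poly p (real (tA A))" .
  then show ?thesis using finite_A sub graver_basis_element[OF r(1)] by blast
qed

theorem theorem4p5:
  shows "(\<forall>p :: real poly. \<exists>(n::nat) (A :: (nat \<Rightarrow> nat) set) u v.
            finite A \<and> A \<subseteq> {x. \<forall>j\<ge>n. x j = 0} \<and>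
            (u, v) \<in> graver_basis A \<and> real (bdeg A u v) > poly p (real (tA A)))
       \<and> (\<forall>n r :: nat. odd n \<and> n \<ge> 3 \<and> r \<ge> 1 \<longrightarrow>
            tA (AG (gedges n r)) \<le> n + (2 * r - 1) * (n - 1) \<and>
            (\<exists>u v. (u, v) \<in> graver_basis (AG (gedges n r)) \<and>
               real (bdeg (AG (gedges n r)) u v)
                 = (real n + real n ^ 2 * ((real n - 1) ^ r - 1) / (real n - 2)) / 2))"
proof (intro conjI allI impI)
  fix p :: "real poly"
  show "\<exists>(n::nat) (A :: (nat \<Rightarrow> nat) set) u v. finite A \<and> A \<subseteq> {x. \<forall>j\<ge>n. x j = 0} \<and>
    (u, v) \<in> graver_basis A \<and> real (bdeg A u v) > poly p (real (tA A))"
    by (rule graver_degree_not_polynomial)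
next
  fix n r :: nat
  assume nr: "odd n \<and> n \<ge> 3 \<and> r \<ge> 1"
  interpret cactus n r "\<lambda>v. v" by unfold_locales (use nr in simp_all)
  have AG: "AG (gedges n r) = A" using AG_gedges by simp
  show "tA (AG (gedges n r)) \<le> n + (2 * r - 1) * (n - 1)" unfolding AG using tA_bound nr by blast
  show "\<exists>u v. (u, v) \<in> graver_basis (AG (gedges n r)) \<and> real (bdeg (AG (gedges n r)) u v)
      = (real n + real n ^ 2 * ((real n - 1) ^ r - 1) / (real n - 2)) / 2"
    unfolding AG using graver_basis_element graver_degree_real nr by blast
qed

end
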